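(* Let $h>0$, $\alpha>2$, $\beta\ge 0$, and let $V\in C^{\alpha,\beta,2}$ satisfy the standing assumptions of the setting (real-valued, $2\pi$-periodic in $t$, $v_0\equiv 0$). Then there is a unitary operator $U$ on $l^2(\mathbb{Z})$ such that $$U^{*}\mathcal{M}U=\mathcal{M}^{(0)}+\mathcal{M}^{(d)}+\mathcal{M}^{(c)},$$ where $\mathcal{M}^{(0)}_{jk}=\delta_{jk}e^{\frac{2\pi}{ih}k^2}$, $\mathcal{M}^{(d)}_{jk}=\delta_{-j,k}\,\frac{e^{\frac{2\pi}{ih}k^2}}{ih}\int_0^{2\pi}v_{-2k}(\tau)\,d\tau$, and for all $j,k\in\mathbb{Z}$ $$|\mathcal{M}^{(c)}_{jk}|\le \frac{c\,e^{-\beta|j-k|}}{\langle j\rangle\langle k\rangle\langle j-k\rangle^{\alpha-1}},$$ with a constant $c$ depending only on $h,c_v,\alpha$.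
   Context: Setting. $\mathbb{T}=\mathbb{R}/2\pi\mathbb{Z}$, $h>0$. $V:\mathbb{T}\times\mathbb{R}\to\mathbb{R}$ is real-valued and $2\pi$-periodic in $t$, with Fourier expansion $V(x,t)=\sum_{k\in\mathbb{Z}}v_k(t)e^{ikx}$ (so $v_{-k}=\overline{v_k}$), and it is assumed that $v_0(t)\equiv 0$. Notation: $\langle k\rangle=|k|+1$; $\delta$ is the Kronecker delta; $e^{\frac{t}{ih}k^2}=e^{-itk^2/h}$. For $\alpha,\gamma\in\mathbb{N}$ (or real $\alpha$) and $\beta\ge0$, $V\in C^{\alpha,\beta,\gamma}$ means $V$ is $C^\gamma$ in $t$ and there is $c_v>0$ with $\|v_k\|_{C^\gamma}\le c_v e^{-\beta|k|}\langle k\rangle^{-\alpha}$ for all $k\in\mathbb{Z}$, where $\|\cdot\|_{C^\gamma}$ is the sup over $t$ of the function and its first $\gamma$ derivatives. The Schrödinger equation $ih\partial_t\psi=-\partial_x^2\psi+V\psi$ on $L^2(\mathbb{T})$, in Fourier coordinates $\psi=\sum\psi_ke^{ikx}$, is the system $ih\dot\psi_k=k^2\psi_k+\sum_{j\in\mathbb{Z}}v_{k-j}(t)\psi_j$ on $l^2(\mathbb{Z})$. $W(t)$ denotes its fundamental solution (unitary propagator, $W(0)=I$), operators on $l^2(\mathbb{Z})$ are identified with infinite matrices in the basis $(e^{ikx})_{k\in\mathbb{Z}}$ (so the $k_0$-th column of $W(t)$ is the solution with $\psi_k(0)=\delta_{kk_0}$), and $\mathcal{M}=W(2\pi)$ is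 the monodromy operator. *)

theory Defs
  imports "HOL-Analysis.Analysis"
begin

definition jbr :: "int \<Rightarrow> real" where
  "jbr k = real_of_int \<bar>k\<bar> + 1"

text \<open>Operators on l2(Z) as infinite matrices indexed by Z x Z (entry A j k = <e_j, A e_k>).\<close>
type_synonym zmat = "int \<Rightarrow> int \<Rightarrow> complex"

definition mat_adj :: "zmat \<Rightarrow> zmat" where
  "mat_adj A j k = cnj (A k j)"

definition mat_mul :: "zmat \<Rightarrow> zmat \<Rightarrow> zmat" where
  "mat_mul A B j k = infsum (\<lambda>l. A j l * B l k) UNIV"

definition unitary_mat :: "zmat \<Rightarrow> bool" where
  "unitary_mat U \<longleftrightarrow>
     (\<forall>j k. ((\<lambda>l. cnj (U l j) * U l k) has_sum (if j = k then 1 else 0)) UNIV) \<and>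
     (\<forall>j k. ((\<lambda>l. U j l * cnj (U k l)) has_sum (if j = k then 1 else 0)) UNIV)"

definition tder :: "(real \<Rightarrow> complex) \<Rightarrow> real \<Rightarrow> complex" where
  "tder f = (\<lambda>t. vector_derivative f (at t))"

text \<open>The class C^{alpha,beta,gamma} with explicit constant cv, for the Fourier coefficients
  v k t of V(x,t) = sum_k v_k(t) e^{ikx}: each v_k is C^gamma in t and
  the sup over t of v_k and its first gamma derivatives is bounded by cv e^{-beta|k|} <k>^{-alpha}.\<close>
definition C_class :: "real \<Rightarrow> real \<Rightarrow> nat \<Rightarrow> real \<Rightarrow> (int \<Rightarrow> real \<Rightarrow> complex) \<Rightarrow> bool" where
  "C_class \<alpha> \<beta> \<gamma> cv v \<longleftrightarrow>
     (\<forall>k. (\<forall>i<\<gamma>. \<forall>t. ((tder ^^ i) (v k)) differentiable (at t)) \<and>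
          continuous_on UNIV ((tder ^^ \<gamma>) (v k)) \<and>
          (\<forall>i\<le>\<gamma>. \<forall>t. norm (((tder ^^ i) (v k)) t) \<le> cv * exp (- \<beta> * \<bar>k\<bar>) / jbr k powr \<alpha>))"

text \<open>W is the fundamental solution (unitary propagator, W(0) = I) of
  i h psi_k' = k^2 psi_k + sum_j v_{k-j}(t) psi_j; column k0 of W t is the solution
  with psi_k(0) = delta_{k k0}.\<close>
definition fund_sol :: "real \<Rightarrow> (int \<Rightarrow> real \<Rightarrow> complex) \<Rightarrow> (real \<Rightarrow> zmat) \<Rightarrow> bool" where
  "fund_sol h v W \<longleftrightarrow>
     (\<forall>j k. W 0 j k = (if j = k then 1 else 0)) \<and>
     (\<forall>t. unitary_mat (W t)) \<and>
     (\<forall>t j k. ((\<lambda>s. W s j k) has_vector_derivative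
        ((of_int (j^2) * W t j k + infsum (\<lambda>l. v (j - l) t * W t l k) UNIV)
          / (\<i> * complex_of_real h))) (at t))"

definition M0 :: "real \<Rightarrow> zmat" where
  "M0 h j k = (if j = k then exp (complex_of_real (2*pi) / (\<i> * complex_of_real h) * of_int (k^2)) else 0)"

definition Md :: "real \<Rightarrow> (int \<Rightarrow> real \<Rightarrow> complex) \<Rightarrow> zmat" where
  "Md h v j k = (if - j = k then
      exp (complex_of_real (2*pi) / (\<i> * complex_of_real h) * of_int (k^2)) / (\<i> * complex_of_real h)
        * integral {0..2*pi} (v (-2*k))
    else 0)"

end

theory Submission
  imports Defs "HOL-Library.Nat_Bijection"
begin

text \<open>Let \<open>X\<close> be the propagator in the interaction picture, so \<open>i h X' = phase(V) X\<close> with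
  \<open>V\<^sub>j\<^sub>k = v\<^sub>j\<^sub>-\<^sub>k\<close> and \<open>phase\<close> the conjugation by the free flow. Nonresonant entries (\<open>j\<^sup>2 \<noteq> k\<^sup>2\<close>) oscillate,
  and integrating them by parts gains \<open>1 / (j\<^sup>2 - k\<^sup>2)\<close>. The bookkeeping uses three classes of matrices:
  an algebra (weight \<open>wW\<close>), an ideal \<open>J\<close> of it (weight \<open>wJ\<close>) containing the quotients \<open>V\<^sub>j\<^sub>k / (j\<^sup>2 - k\<^sup>2)\<close>
  and the antidiagonal part of \<open>V\<close>, and an ideal \<open>T\<close> (weight \<open>wT\<close>, the bound to be proved) with \<open>J J \<subseteq> T\<close>;
  dividing an element of \<open>J\<close> by \<open>j\<^sup>2 - k\<^sup>2\<close> leads to \<open>T\<close>. Hence two integrations by parts (\<open>V \<in> C\<^sup>2\<close> in time)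
  leave an error in \<open>T\<close>, except for the resonant entries of the second-order term; on the antidiagonal
  these are small by convolution, and on the diagonal because reality of the potential makes the terms
  \<open>m\<close> and \<open>-m\<close> nearly cancel. Modulo \<open>T\<close>, the monodromy is then \<open>M\<^sub>0 + M\<^sub>d\<close> up to a commutator with the skew matrix \<open>L\<close>,
  \<open>L\<^sub>j\<^sub>k = v\<^sub>j\<^sub>-\<^sub>k(0) / (j\<^sup>2 - k\<^sup>2)\<close>, and since \<open>J J \<subseteq> T\<close> the commutator is removed by \<open>U = exp(-L)\<close>.\<close>

section \<open>Weighted infinite matrices\<close>

lemma jbr_ge_1: "1 \<le> jbr k"
  and jbr_pos: "0 < jbr k"
  and jbr_nonneg: "0 \<le> jbr k"
  and jbr_minus: "jbr (- k) = jbr k"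
  and jbr_diff_commute: "jbr (j - k) = jbr (k - j)"
  and jbr_add_le: "jbr (j + k) \<le> jbr j + jbr k"
  by (auto simp: jbr_def)

text \<open>A Peetre-type inequality: it moves a weight from one index to another at the cost of one
  power of the bracket of their difference. The products of weighted classes below pay this cost out
  of the decay of the kernel.\<close>

lemma jbr_le_mult: "jbr j \<le> jbr (j - k) * jbr k"
proof -
  have "real_of_int \<bar>j\<bar> \<le> real_of_int \<bar>j - k\<bar> + real_of_int \<bar>k\<bar>" by linarith
  moreover have "0 \<le> real_of_int \<bar>j - k\<bar> * real_of_int \<bar>k\<bar>" by simp
  ultimately show ?thesis unfolding jbr_def by (simp only: ring_distribs)
qed

lemma summable_on_jbr_powr:
  assumes "a > 1"
  shows "(\<lambda>l. 1 / jbr l powr a) summable_on UNIV"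
proof -
  have s: "(\<lambda>n::nat. 1 / (real n + 1) powr a) summable_on UNIV"
  proof (rule summable_nonneg_imp_summable_on)
    have "summable (\<lambda>n. real (Suc n) powr (- a))"
      using summable_real_powr_iff[of "-a"] assms by (subst summable_Suc_iff) simp
    then show "summable (\<lambda>n::nat. 1 / (real n + 1) powr a)"
      by (simp add: powr_minus_divide add.commute)
  qed simp
  have "(\<lambda>l. 1 / jbr l powr a) summable_on range int"
    by (subst summable_on_reindex) (use s in \<open>auto simp: o_def jbr_def\<close>)
  moreover have "(\<lambda>l. 1 / jbr l powr a) summable_on range (\<lambda>n. - int n)"
    by (subst summable_on_reindex) (use s in \<open>auto simp: o_def jbr_def inj_def\<close>)
  moreover have "range int \<union> range (\<lambda>n. - int n) = (UNIV :: int set)"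
    by (auto simp: image_iff) (metis int_cases2)
  ultimately show ?thesis
    by (metis summable_on_union)
qed

section \<open>Convolution estimates for the decay kernel\<close>

definition kern :: "real \<Rightarrow> real \<Rightarrow> int \<Rightarrow> int \<Rightarrow> real" where
  "kern a b j k = exp (- b * \<bar>j - k\<bar>) / jbr (j - k) powr a"

lemma kern_pos: "0 < kern a b j k"
  using jbr_pos[of "j - k"] by (simp add: kern_def)

lemma kern_nonneg: "0 \<le> kern a b j k"
  using kern_pos[of a b j k] by simp

lemma kern_commute: "kern a b j k = kern a b k j"
  by (simp add: kern_def jbr_diff_commute[of j k] abs_minus_commute[of j k])

lemma kern_self: "kern a b j j = 1"
  by (simp add: kern_def jbr_def)

lemma kern_diff_1: "kern (a - 1) b j k = kern a b j k * jbr (j - k)"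
  using jbr_pos[of "j - k"] by (simp add: kern_def powr_diff)

text \<open>By the triangle inequality \<open>jbr (j - k)\<close> is at most twice the larger of
  \<open>jbr (j - l)\<close> and \<open>jbr (l - k)\<close>. The kernel factor with the larger
  bracket supplies the decay in \<open>j - k\<close>; the other stays available for summation over
  \<open>l\<close>.\<close>

lemma kern_mult_le:
  assumes "a \<ge> 0" "b \<ge> 0"
  shows "kern a b j l * kern a b l k
    \<le> 2 powr a * kern a b j k * (1 / jbr (j - l) powr a + 1 / jbr (l - k) powr a)"
proof -
  define x y z where "x = jbr (j - l)" and "y = jbr (l - k)" and "z = jbr (j - k)"
  have pos: "x > 0" "y > 0" "z > 0" by (simp_all add: x_def y_def z_def jbr_pos)
  have "z \<le> x + y"
    using jbr_add_le[of "j - l" "l - k"] by (simp add: x_def y_def z_def)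
  then have z: "z \<le> 2 * max x y" by linarith
  have "z powr a \<le> (2 * max x y) powr a"
    using z pos assms by (intro powr_mono2) auto
  also have "\<dots> = 2 powr a * max x y powr a"
    using pos by (simp add: powr_mult)
  finally have zp: "z powr a \<le> 2 powr a * max x y powr a" .
  have "1 / (x powr a * y powr a) \<le> 2 powr a / z powr a * (1 / x powr a + 1 / y powr a)"
  proof (cases "x \<le> y")
    case True
    then have "1 / y powr a \<le> 2 powr a / z powr a"
      using zp pos by (simp add: field_simps max_def)
    then have "1 / y powr a * (1 / x powr a) \<le> 2 powr a / z powr a * (1 / x powr a + 1 / y powr a)"
      by (intro mult_mono) auto
    then show ?thesis by (simp add: mult.commute)
  next
    case False
    then have "1 / x powr a \<le> 2 powr a / z powr a"
      using zp pos by (simp add: field_simps max_def)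
    then have "1 / x powr a * (1 / y powr a) \<le> 2 powr a / z powr a * (1 / x powr a + 1 / y powr a)"
      by (intro mult_mono) auto
    then show ?thesis by simp
  qed
  moreover have "exp (- b * \<bar>j - l\<bar>) * exp (- b * \<bar>l - k\<bar>) \<le> exp (- b * \<bar>j - k\<bar>)"
  proof -
    have "b * real_of_int \<bar>j - k\<bar> \<le> b * (real_of_int \<bar>j - l\<bar> + real_of_int \<bar>l - k\<bar>)"
      using assms by (intro mult_left_mono) linarith+
    then show ?thesis by (simp flip: exp_add add: algebra_simps)
  qed
  ultimately have "(exp (- b * \<bar>j - l\<bar>) * exp (- b * \<bar>l - k\<bar>)) * (1 / (x powr a * y powr a))
      \<le> exp (- b * \<bar>j - k\<bar>) * (2 powr a / z powr a * (1 / x powr a + 1 / y powr a))"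
    by (intro mult_mono) auto
  then show ?thesis
    by (simp add: kern_def x_def y_def z_def mult_ac)
qed

text \<open>The rate \<open>b\<close> does not occur here, which is what keeps the final constant
  independent of \<beta>. The leading 2 counts the two summands in
  \<open>kern_mult_le\<close>.\<close>

definition conv_const :: "real \<Rightarrow> real" where
  "conv_const a = 2 * 2 powr a * (\<Sum>\<^sub>\<infinity>l. 1 / jbr l powr a)"

lemma
  assumes "a > 1" "b \<ge> 0"
  shows kern_conv_summable: "(\<lambda>l. kern a b j l * kern a b l k) summable_on UNIV"
    and kern_conv_le: "(\<Sum>\<^sub>\<infinity>l. kern a b j l * kern a b l k) \<le> conv_const a * kern a b j k"
proof -
  note s = summable_on_jbr_powr[OF assms(1)]
  have bj: "bij (\<lambda>l. j - l)" and bk: "bij (\<lambda>l::int. l - k)"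
    by (auto intro!: bijI' intro: exI[of _ "_ + k"] exI[of _ "j - _"] simp: algebra_simps)
  have s1: "(\<lambda>l. 1 / jbr (j - l) powr a) summable_on UNIV"
    using summable_on_reindex_bij_betw[OF bj, of "\<lambda>l. 1 / jbr l powr a"] s by simp
  have s2: "(\<lambda>l. 1 / jbr (l - k) powr a) summable_on UNIV"
    using summable_on_reindex_bij_betw[OF bk, of "\<lambda>l. 1 / jbr l powr a"] s by simp
  have e1: "(\<Sum>\<^sub>\<infinity>l. 1 / jbr (j - l) powr a) = (\<Sum>\<^sub>\<infinity>l. 1 / jbr l powr a)"
    using infsum_reindex_bij_betw[OF bj, of "\<lambda>l. 1 / jbr l powr a"] by simp
  have e2: "(\<Sum>\<^sub>\<infinity>l. 1 / jbr (l - k) powr a) = (\<Sum>\<^sub>\<infinity>l. 1 / jbr l powr a)"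
    using infsum_reindex_bij_betw[OF bk, of "\<lambda>l. 1 / jbr l powr a"] by simp
  let ?g = "\<lambda>l. 2 powr a * kern a b j k * (1 / jbr (j - l) powr a + 1 / jbr (l - k) powr a)"
  have g: "?g summable_on UNIV"
    by (intro summable_on_cmult_right summable_on_add s1 s2)
  have le: "kern a b j l * kern a b l k \<le> ?g l" for l
    using assms by (intro kern_mult_le) auto
  show sm: "(\<lambda>l. kern a b j l * kern a b l k) summable_on UNIV"
    using le by (intro summable_on_comparison_test[OF g]) (auto simp: kern_nonneg)
  have "(\<Sum>\<^sub>\<infinity>l. kern a b j l * kern a b l k) \<le> infsum ?g UNIV"
    using le by (intro infsum_mono sm g)
  also have "\<dots> = conv_const a * kern a b j k"
    by (subst infsum_cmult_right', subst infsum_add[OF s1 s2]) (simp add: e1 e2 conv_const_def)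
  finally show "(\<Sum>\<^sub>\<infinity>l. kern a b j l * kern a b l k) \<le> conv_const a * kern a b j k" .
qed

text \<open>The term \<open>l = 0\<close> of the convolution at \<open>j = k = 0\<close> is already
  1.\<close>

lemma conv_const_ge_1:
  assumes "a > 1"
  shows "1 \<le> conv_const a"
proof -
  have "(\<Sum>l\<in>{0}. kern a 0 0 l * kern a 0 l 0) \<le> (\<Sum>\<^sub>\<infinity>l. kern a 0 0 l * kern a 0 l 0)"
    using kern_conv_summable[OF assms, of 0 0 0]
    by (intro finite_sum_le_infsum) (auto simp: kern_nonneg)
  also have "\<dots> \<le> conv_const a * kern a 0 0 0"
    using assms by (intro kern_conv_le) auto
  finally show ?thesis by (simp add: kern_self)
qed

definition bdd_by :: "(int \<Rightarrow> int \<Rightarrow> real) \<Rightarrow> real \<Rightarrow> zmat \<Rightarrow> bool" where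
  "bdd_by w c A \<longleftrightarrow> (\<forall>j k. norm (A j k) \<le> c * w j k)"

lemma bdd_byD: "bdd_by w c A \<Longrightarrow> norm (A j k) \<le> c * w j k"
  by (simp add: bdd_by_def)

text \<open>One estimate behind all products of the weighted classes: \<open>g\<close> collects the
  part of the weights that can be pulled out of the sum over \<open>l\<close>.\<close>

lemma
  assumes "a > 1" "b \<ge> 0"
    and A: "bdd_by p c A" and B: "bdd_by r d B"
    and nonneg: "c \<ge> 0" "d \<ge> 0" "\<And>j k. p j k \<ge> 0" "\<And>j k. r j k \<ge> 0"
    and pr: "\<And>l. p j l * r l k \<le> g * (kern a b j l * kern a b l k)"
  shows mat_mul_abs_summable: "(\<lambda>l. norm (A j l * B l k)) summable_on UNIV"
    and norm_mat_mul_le: "norm (mat_mul A B j k) \<le> c * d * conv_const a * (g * kern a b j k)"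
proof -
  let ?g = "\<lambda>l. c * d * g * (kern a b j l * kern a b l k)"
  have g: "?g summable_on UNIV"
    by (intro summable_on_cmult_right kern_conv_summable assms)
  have le: "norm (A j l * B l k) \<le> ?g l" for l
  proof -
    have "norm (A j l * B l k) \<le> (c * p j l) * (d * r l k)"
      unfolding norm_mult using nonneg
      by (intro mult_mono bdd_byD[OF A] bdd_byD[OF B]) auto
    also have "\<dots> = c * d * (p j l * r l k)" by simp
    also have "\<dots> \<le> c * d * (g * (kern a b j l * kern a b l k))"
      using nonneg by (intro mult_left_mono pr) auto
    finally show ?thesis by (simp add: mult.assoc)
  qed
  show sm: "(\<lambda>l. norm (A j l * B l k)) summable_on UNIV"
    using le by (intro summable_on_comparison_test[OF g]) auto
  \<comment> \<open>The sign of \<open>g\<close> is read off from \<open>pr\<close> at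
    \<open>l = j\<close>, where \<open>kern a b j j = 1\<close>.\<close>
  have "p j j * r j k \<le> g * (kern a b j j * kern a b j k)" by (rule pr)
  moreover have "0 \<le> p j j * r j k" using nonneg by simp
  ultimately have "g * kern a b j k \<ge> 0" by (simp add: kern_self)
  then have g0: "g \<ge> 0" using kern_pos[of a b j k] by (simp add: zero_le_mult_iff not_le)
  have "norm (mat_mul A B j k) \<le> (\<Sum>\<^sub>\<infinity>l. norm (A j l * B l k))"
    unfolding mat_mul_def by (rule norm_infsum_bound[OF sm])
  also have "\<dots> \<le> infsum ?g UNIV"
    using le by (intro infsum_mono sm g)
  also have "\<dots> = c * d * g * (\<Sum>\<^sub>\<infinity>l. kern a b j l * kern a b l k)"
    by (rule infsum_cmult_right')
  also have "\<dots> \<le> c * d * g * (conv_const a * kern a b j k)"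
    using nonneg g0 assms by (intro mult_left_mono kern_conv_le) auto
  finally show "norm (mat_mul A B j k) \<le> c * d * conv_const a * (g * kern a b j k)"
    by (simp add: mult_ac)
qed

definition mat_one :: zmat where
  "mat_one j k = (if j = k then 1 else 0)"

lemma infsum_single_point:
  fixes f :: "'a \<Rightarrow> 'b :: {topological_comm_monoid_add, t2_space}"
  assumes "\<And>x. x \<noteq> a \<Longrightarrow> f x = 0"
  shows "infsum f UNIV = f a"
proof -
  have "infsum f UNIV = infsum f {a}"
    using assms by (intro infsum_cong_neutral) auto
  then show ?thesis by simp
qed

lemma mat_mul_one_left: "mat_mul mat_one A = A"
proof (intro ext)
  fix j k
  show "mat_mul mat_one A j k = A j k"
    unfolding mat_mul_def by (subst infsum_single_point[where a = j]) (auto simp: mat_one_def)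
qed

lemma mat_mul_one_right: "mat_mul A mat_one = A"
proof (intro ext)
  fix j k
  show "mat_mul A mat_one j k = A j k"
    unfolding mat_mul_def by (subst infsum_single_point[where a = k]) (auto simp: mat_one_def)
qed

section \<open>The three weighted classes and their products\<close>

locale weights =
  fixes \<alpha> :: real
  assumes alpha: "\<alpha> > 2"
begin

definition wW :: "real \<Rightarrow> int \<Rightarrow> int \<Rightarrow> real" where
  "wW b j k = kern \<alpha> b j k"

text \<open>The maximum is what division by \<open>j^2 - k^2\<close> gains on nonresonant entries.
  The exponent \<open>\<alpha> - 1\<close> in place of \<open>\<alpha>\<close> leaves room for the
  power of the bracket that is lost when this weight is carried across a factor bounded by
  \<open>wW\<close>.\<close>

definition wJ :: "real \<Rightarrow> int \<Rightarrow> int \<Rightarrow> real" where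
  "wJ b j k = kern (\<alpha> - 1) b j k / max (jbr j) (jbr k)"

definition wT :: "real \<Rightarrow> int \<Rightarrow> int \<Rightarrow> real" where
  "wT b j k = kern (\<alpha> - 1) b j k / (jbr j * jbr k)"

lemma max_jbr_pos: "0 < max (jbr j) (jbr k)"
  using jbr_pos[of j] by linarith

lemma wW_pos: "0 < wW b j k" and wJ_pos: "0 < wJ b j k" and wT_pos: "0 < wT b j k"
  by (auto simp: wW_def wJ_def wT_def kern_pos jbr_pos max_jbr_pos)

lemmas w_nonneg = wW_pos[THEN less_imp_le] wJ_pos[THEN less_imp_le] wT_pos[THEN less_imp_le]

lemma bdd_by_nonneg: "bdd_by (wW b) c A \<Longrightarrow> 0 \<le> c" "bdd_by (wJ b) c A \<Longrightarrow> 0 \<le> c"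
  "bdd_by (wT b) c A \<Longrightarrow> 0 \<le> c"
  using order_trans[OF norm_ge_zero bdd_byD] wW_pos[of b 0 0] wJ_pos[of b 0 0] wT_pos[of b 0 0]
  by (metis zero_le_mult_iff not_less)+

lemma wT_le_wJ: "wT b j k \<le> wJ b j k"
proof -
  have "max (jbr j) (jbr k) \<le> jbr j * jbr k"
    using mult_left_mono[OF jbr_ge_1[of j] jbr_nonneg[of k]]
      mult_left_mono[OF jbr_ge_1[of k] jbr_nonneg[of j]] by (auto simp: mult.commute)
  then show ?thesis
    unfolding wT_def wJ_def
    by (intro divide_left_mono mult_pos_pos kern_nonneg max_jbr_pos jbr_pos)
qed

text \<open>The bracket of \<open>j - k\<close> is at most twice the maximum in \<open>wJ\<close>,
  so the denominator restores the missing power of the kernel.\<close>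

lemma wJ_le_wW: "wJ b j k \<le> 2 * wW b j k"
proof -
  have "jbr (j - k) \<le> 2 * max (jbr j) (jbr k)"
    using jbr_add_le[of j "- k"] by (simp add: jbr_minus)
  then have "kern \<alpha> b j k * jbr (j - k) \<le> kern \<alpha> b j k * (2 * max (jbr j) (jbr k))"
    by (intro mult_left_mono kern_nonneg)
  then show ?thesis
    unfolding wJ_def wW_def kern_diff_1 using max_jbr_pos[of j k]
    by (simp add: pos_divide_le_eq mult_ac)
qed

definition K where "K = conv_const \<alpha> + conv_const (\<alpha> - 1)"

lemma K_ge_1: "1 \<le> K"
  using conv_const_ge_1[of \<alpha>] conv_const_ge_1[of "\<alpha> - 1"] alpha by (simp add: K_def)

lemma K_pos: "0 < K" using K_ge_1 by simp

lemma bdd_by_mono: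
  assumes "bdd_by w c A" "0 \<le> c" "\<And>j k. w j k \<le> e * w' j k"
  shows "bdd_by w' (c * e) A"
  unfolding bdd_by_def
proof safe
  fix j k
  have "norm (A j k) \<le> c * w j k" using assms by (simp add: bdd_byD)
  also have "\<dots> \<le> c * (e * w' j k)" using assms by (intro mult_left_mono)
  finally show "norm (A j k) \<le> c * e * w' j k" by (simp add: mult.assoc)
qed

lemma bdd_by_mat_mul:
  assumes "a = \<alpha> \<or> a = \<alpha> - 1" "0 \<le> b" "bdd_by p c A" "bdd_by r d B"
    and "0 \<le> c" "0 \<le> d" "\<And>j k. 0 \<le> p j k" "\<And>j k. 0 \<le> r j k"
    and "\<And>j l k. p j l * r l k \<le> g j k * (kern a b j l * kern a b l k)"
    and "\<And>j k. w j k = g j k * kern a b j k" "\<And>j k. 0 \<le> w j k"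
  shows "bdd_by w (K * c * d) (mat_mul A B)"
  unfolding bdd_by_def
proof safe
  fix j k
  have a: "a > 1" using assms(1) alpha by auto
  have K: "conv_const a \<le> K"
    using assms(1) conv_const_ge_1[of \<alpha>] conv_const_ge_1[of "\<alpha> - 1"] alpha by (auto simp: K_def)
  have "norm (mat_mul A B j k) \<le> c * d * conv_const a * (g j k * kern a b j k)"
    using a assms by (intro norm_mat_mul_le[of a b p c A r d B]) auto
  also have "\<dots> = conv_const a * (c * d * w j k)" by (simp add: assms mult_ac)
  also have "\<dots> \<le> K * (c * d * w j k)"
    using K assms by (intro mult_right_mono) auto
  finally show "norm (mat_mul A B j k) \<le> K * c * d * w j k" by (simp add: mult_ac)
qed

lemma bdd_by_mat_mul_WW:
  assumes "0 \<le> b" "bdd_by (wW b) c A" "bdd_by (wW b) d B"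
  shows "bdd_by (wW b) (K * c * d) (mat_mul A B)"
  using assms
  by (intro bdd_by_mat_mul[where a = \<alpha> and b = b and p = "wW b" and r = "wW b" and g = "\<lambda>_ _. 1"])
     (auto simp: w_nonneg bdd_by_nonneg, auto simp: wW_def)

text \<open>Each maximum is bounded below by the outer index: \<open>jbr j\<close> is kept from the
  left factor and \<open>jbr k\<close> from the right one. The sum over \<open>l\<close> converges
  because \<open>\<alpha> - 1 > 1\<close>.\<close>

lemma bdd_by_mat_mul_JJ:
  assumes "0 \<le> b" "bdd_by (wJ b) c A" "bdd_by (wJ b) d B"
  shows "bdd_by (wT b) (K * c * d) (mat_mul A B)"
proof (rule bdd_by_mat_mul[where a = "\<alpha> - 1" and b = b and p = "wJ b" and r = "wJ b"
        and g = "\<lambda>j k. 1 / (jbr j * jbr k)"])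
  fix j l k
  have "kern (\<alpha> - 1) b j l / max (jbr j) (jbr l) \<le> kern (\<alpha> - 1) b j l / jbr j"
    by (intro divide_left_mono) (auto simp: kern_nonneg jbr_pos max_jbr_pos)
  moreover have "kern (\<alpha> - 1) b l k / max (jbr l) (jbr k) \<le> kern (\<alpha> - 1) b l k / jbr k"
    by (intro divide_left_mono) (auto simp: kern_nonneg jbr_pos max_jbr_pos)
  ultimately have "wJ b j l * wJ b l k \<le> (kern (\<alpha> - 1) b j l / jbr j) * (kern (\<alpha> - 1) b l k / jbr k)"
    unfolding wJ_def using max_jbr_pos by (intro mult_mono) (auto simp: kern_nonneg jbr_nonneg less_imp_le)
  then show "wJ b j l * wJ b l k
      \<le> 1 / (jbr j * jbr k) * (kern (\<alpha> - 1) b j l * kern (\<alpha> - 1) b l k)"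
    by simp
qed (use assms in \<open>auto simp: w_nonneg bdd_by_nonneg\<close>, auto simp: wT_def)

lemma max_jbr_le: "max (jbr j) (jbr k) \<le> jbr (j - l) * max (jbr l) (jbr k)"
  "max (jbr j) (jbr k) \<le> jbr (l - k) * max (jbr j) (jbr l)"
proof -
  have "1 * jbr k \<le> jbr (j - l) * jbr k" "1 * jbr j \<le> jbr (l - k) * jbr j"
    by (intro mult_right_mono jbr_ge_1 jbr_nonneg)+
  moreover have "jbr j \<le> jbr (j - l) * jbr l" "jbr k \<le> jbr (l - k) * jbr l"
    using jbr_le_mult[of j l] jbr_le_mult[of k l] by (auto simp: jbr_diff_commute[of k l])
  moreover have "jbr (j - l) * max (jbr l) (jbr k) = max (jbr (j - l) * jbr l) (jbr (j - l) * jbr k)"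
    "jbr (l - k) * max (jbr j) (jbr l) = max (jbr (l - k) * jbr j) (jbr (l - k) * jbr l)"
    using jbr_nonneg[of "j - l"] jbr_nonneg[of "l - k"] by (simp_all add: max_mult_distrib_left)
  ultimately show "max (jbr j) (jbr k) \<le> jbr (j - l) * max (jbr l) (jbr k)"
    "max (jbr j) (jbr k) \<le> jbr (l - k) * max (jbr j) (jbr l)" by auto
qed

text \<open>Transferring the maximum from \<open>(l, k)\<close> to \<open>(j, k)\<close> costs
  \<open>jbr (j - l)\<close> by \<open>max_jbr_le\<close>, exactly the surplus of
  \<open>kern \<alpha>\<close> over \<open>kern (\<alpha> - 1)\<close>.\<close>

lemma bdd_by_mat_mul_WJ:
  assumes "0 \<le> b" "bdd_by (wW b) c A" "bdd_by (wJ b) d B"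
  shows "bdd_by (wJ b) (K * c * d) (mat_mul A B)"
proof (rule bdd_by_mat_mul[where a = "\<alpha> - 1" and b = b and p = "wW b" and r = "wJ b"
        and g = "\<lambda>j k. 1 / max (jbr j) (jbr k)"])
  fix j l k
  have "max (jbr j) (jbr k) * (kern \<alpha> b j l * kern (\<alpha> - 1) b l k)
      \<le> (jbr (j - l) * max (jbr l) (jbr k)) * (kern \<alpha> b j l * kern (\<alpha> - 1) b l k)"
    by (intro mult_right_mono max_jbr_le mult_nonneg_nonneg kern_nonneg)
  then show "wW b j l * wJ b l k
      \<le> 1 / max (jbr j) (jbr k) * (kern (\<alpha> - 1) b j l * kern (\<alpha> - 1) b l k)"
    unfolding wW_def wJ_def kern_diff_1[of \<alpha> b j l] using max_jbr_pos[of j k] max_jbr_pos[of l k]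
    by (simp add: divide_simps mult_ac)
qed (use assms in \<open>auto simp: w_nonneg bdd_by_nonneg\<close>, auto simp: wJ_def)

lemma bdd_by_mat_mul_JW:
  assumes "0 \<le> b" "bdd_by (wJ b) c A" "bdd_by (wW b) d B"
  shows "bdd_by (wJ b) (K * c * d) (mat_mul A B)"
proof (rule bdd_by_mat_mul[where a = "\<alpha> - 1" and b = b and p = "wJ b" and r = "wW b"
        and g = "\<lambda>j k. 1 / max (jbr j) (jbr k)"])
  fix j l k
  have "max (jbr j) (jbr k) * (kern (\<alpha> - 1) b j l * kern \<alpha> b l k)
      \<le> (jbr (l - k) * max (jbr j) (jbr l)) * (kern (\<alpha> - 1) b j l * kern \<alpha> b l k)"
    by (intro mult_right_mono max_jbr_le mult_nonneg_nonneg kern_nonneg)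
  then show "wJ b j l * wW b l k
      \<le> 1 / max (jbr j) (jbr k) * (kern (\<alpha> - 1) b j l * kern (\<alpha> - 1) b l k)"
    unfolding wW_def wJ_def kern_diff_1[of \<alpha> b l k] using max_jbr_pos[of j k] max_jbr_pos[of j l]
    by (simp add: divide_simps mult_ac)
qed (use assms in \<open>auto simp: w_nonneg bdd_by_nonneg\<close>, auto simp: wJ_def)

text \<open>Only \<open>jbr l\<close> has to be turned into \<open>jbr j\<close>, since
  \<open>jbr k\<close> is already in place; \<open>jbr_le_mult\<close> is paid with the same surplus
  power as in \<open>bdd_by_mat_mul_WJ\<close>.\<close>

lemma bdd_by_mat_mul_WT:
  assumes "0 \<le> b" "bdd_by (wW b) c A" "bdd_by (wT b) d B"
  shows "bdd_by (wT b) (K * c * d) (mat_mul A B)"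
proof (rule bdd_by_mat_mul[where a = "\<alpha> - 1" and b = b and p = "wW b" and r = "wT b"
        and g = "\<lambda>j k. 1 / (jbr j * jbr k)"])
  fix j l k
  have "jbr j * (kern \<alpha> b j l * kern (\<alpha> - 1) b l k)
      \<le> (jbr (j - l) * jbr l) * (kern \<alpha> b j l * kern (\<alpha> - 1) b l k)"
    by (intro mult_right_mono jbr_le_mult mult_nonneg_nonneg kern_nonneg)
  then show "wW b j l * wT b l k
      \<le> 1 / (jbr j * jbr k) * (kern (\<alpha> - 1) b j l * kern (\<alpha> - 1) b l k)"
    unfolding wW_def wT_def kern_diff_1[of \<alpha> b j l] using jbr_pos[of j] jbr_pos[of k] jbr_pos[of l]
    by (simp add: divide_simps mult_ac)
qed (use assms in \<open>auto simp: w_nonneg bdd_by_nonneg\<close>, auto simp: wT_def)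

lemma bdd_by_mat_mul_TW:
  assumes "0 \<le> b" "bdd_by (wT b) c A" "bdd_by (wW b) d B"
  shows "bdd_by (wT b) (K * c * d) (mat_mul A B)"
proof (rule bdd_by_mat_mul[where a = "\<alpha> - 1" and b = b and p = "wT b" and r = "wW b"
        and g = "\<lambda>j k. 1 / (jbr j * jbr k)"])
  fix j l k
  have "jbr k * (kern (\<alpha> - 1) b j l * kern \<alpha> b l k)
      \<le> (jbr (l - k) * jbr l) * (kern (\<alpha> - 1) b j l * kern \<alpha> b l k)"
    using jbr_le_mult[of k l] unfolding jbr_diff_commute[of k l]
    by (intro mult_right_mono mult_nonneg_nonneg kern_nonneg)
  then show "wT b j l * wW b l k
      \<le> 1 / (jbr j * jbr k) * (kern (\<alpha> - 1) b j l * kern (\<alpha> - 1) b l k)"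
    unfolding wW_def wT_def kern_diff_1[of \<alpha> b l k] using jbr_pos[of j] jbr_pos[of k] jbr_pos[of l]
    by (simp add: divide_simps mult_ac)
qed (use assms in \<open>auto simp: w_nonneg bdd_by_nonneg\<close>, auto simp: wT_def)

lemma bdd_by_mat_one: "bdd_by (wW b) 1 mat_one"
  by (auto simp: bdd_by_def mat_one_def wW_def kern_self kern_nonneg)

section \<open>Algebraic laws for products with absolutely convergent sums\<close>

definition inW :: "real \<Rightarrow> zmat \<Rightarrow> bool" where
  "inW b A \<longleftrightarrow> 0 \<le> b \<and> (\<exists>c. bdd_by (wW b) c A)"

lemma inW_mat_mul: "inW b A \<Longrightarrow> inW b B \<Longrightarrow> inW b (mat_mul A B)"
  unfolding inW_def using bdd_by_mat_mul_WW by metis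

lemma inW_abs_summable:
  assumes "inW b A" "inW b B"
  shows "(\<lambda>l. norm (A j l * B l k)) summable_on UNIV"
proof -
  obtain c d where "bdd_by (wW b) c A" "bdd_by (wW b) d B" "0 \<le> b"
    using assms by (auto simp: inW_def)
  then show ?thesis
    using alpha
    by (intro mat_mul_abs_summable[where a = \<alpha> and b = b and p = "wW b" and r = "wW b"
          and c = c and d = d and g = 1])
       (auto simp: w_nonneg bdd_by_nonneg, auto simp: wW_def)
qed

lemmas inW_summable = abs_summable_summable[OF inW_abs_summable]

lemma mat_mul_add_left:
  assumes "inW b A" "inW b B" "inW b C"
  shows "mat_mul (\<lambda>j k. A j k + B j k) C j k = mat_mul A C j k + mat_mul B C j k"
  unfolding mat_mul_def distrib_right
  by (intro infsum_add inW_summable[OF assms(1,3)] inW_summable[OF assms(2,3)])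

lemma mat_mul_add_right:
  assumes "inW b A" "inW b B" "inW b C"
  shows "mat_mul C (\<lambda>j k. A j k + B j k) j k = mat_mul C A j k + mat_mul C B j k"
  unfolding mat_mul_def distrib_left
  by (intro infsum_add inW_summable[OF assms(3,1)] inW_summable[OF assms(3,2)])

lemma mat_mul_scale_left: "mat_mul (\<lambda>j k. c * A j k) B j k = c * mat_mul A B j k"
  unfolding mat_mul_def by (subst infsum_cmult_right'[symmetric]) (simp add: mult_ac)

lemma mat_mul_scale_right: "mat_mul B (\<lambda>j k. c * A j k) j k = c * mat_mul B A j k"
  unfolding mat_mul_def by (subst infsum_cmult_right'[symmetric]) (simp add: mult_ac)

lemma mat_mul_uminus_left: "mat_mul (\<lambda>j k. - A j k) B j k = - mat_mul A B j k"
  using mat_mul_scale_left[of "-1"] by simp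

lemma mat_mul_uminus_right: "mat_mul B (\<lambda>j k. - A j k) j k = - mat_mul B A j k"
  using mat_mul_scale_right[of B "-1"] by simp

text \<open>Fubini for the double series. Its absolute convergence follows from the algebra property
  applied to the matrices of absolute values.\<close>

lemma mat_mul_assoc:
  assumes "inW b A" "inW b B" "inW b C"
  shows "mat_mul (mat_mul A B) C = mat_mul A (mat_mul B C)"
proof (intro ext)
  fix j k
  obtain c1 c2 c3 where c: "bdd_by (wW b) c1 A" "bdd_by (wW b) c2 B" "bdd_by (wW b) c3 C" and b: "0 \<le> b"
    using assms by (auto simp: inW_def)
  let ?f = "\<lambda>(l,m). A j m * B m l * C l k"
  have absA: "inW b (\<lambda>j k. complex_of_real (norm (A j k)))"
    and absB: "inW b (\<lambda>j k. complex_of_real (norm (B j k)))"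
    and absC: "inW b (\<lambda>j k. complex_of_real (norm (C j k)))"
    using assms by (simp_all add: inW_def bdd_by_def)
  have "(\<lambda>x. norm (?f x)) summable_on (UNIV \<times> UNIV)"
    unfolding Infinite_Sum.abs_summable_on_Sigma_iff
  proof (intro conjI ballI)
    fix l
    show "(\<lambda>m. norm (case (l, m) of (l, m) \<Rightarrow> A j m * B m l * C l k)) summable_on UNIV"
      using inW_abs_summable[OF assms(1,2), of j l]
      by (simp add: norm_mult summable_on_cmult_left)
  next
    let ?M = "mat_mul (\<lambda>j k. complex_of_real (norm (A j k))) (\<lambda>j k. complex_of_real (norm (B j k)))"
    have M: "norm (\<Sum>\<^sub>\<infinity>m. norm (A j m * B m l * C l k)) = norm (?M j l * complex_of_real (norm (C l k)))" for l
    proof -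
      have "?M j l = complex_of_real (\<Sum>\<^sub>\<infinity>m. norm (A j m) * norm (B m l))"
        using infsumI[OF has_sum_of_real[OF has_sum_infsum[OF inW_abs_summable[OF assms(1,2), of j l]]]]
        by (simp add: mat_mul_def norm_mult)
      then show ?thesis
        by (simp add: norm_mult infsum_cmult_left' abs_mult)
    qed
    have "(\<lambda>l. norm (?M j l * complex_of_real (norm (C l k)))) summable_on UNIV"
      by (intro inW_abs_summable[of b] inW_mat_mul absA absB absC)
    then show "(\<lambda>l. norm (\<Sum>\<^sub>\<infinity>m. norm (case (l, m) of (l, m) \<Rightarrow> A j m * B m l * C l k))) summable_on UNIV"
      by (simp add: M del: norm_mult real_norm_def)
  qed
  then have s: "?f summable_on UNIV \<times> UNIV" by (rule abs_summable_summable)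
  have "mat_mul (mat_mul A B) C j k = (\<Sum>\<^sub>\<infinity>l. \<Sum>\<^sub>\<infinity>m. A j m * B m l * C l k)"
    by (simp add: mat_mul_def infsum_cmult_left')
  also have "\<dots> = (\<Sum>\<^sub>\<infinity>m. \<Sum>\<^sub>\<infinity>l. A j m * B m l * C l k)"
    using s by (rule infsum_swap_banach)
  also have "\<dots> = mat_mul A (mat_mul B C) j k"
    by (simp add: mat_mul_def mult.assoc infsum_cmult_right')
  finally show "mat_mul (mat_mul A B) C j k = mat_mul A (mat_mul B C) j k" .
qed

end

section \<open>Exponentials of skew-adjoint matrices\<close>

lemma has_sum_finite_sum:
  fixes f :: "'i \<Rightarrow> 'a \<Rightarrow> 'b::topological_comm_monoid_add"
  assumes "finite I" "\<And>i. i \<in> I \<Longrightarrow> (f i has_sum s i) A"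
  shows "((\<lambda>x. \<Sum>i\<in>I. f i x) has_sum (\<Sum>i\<in>I. s i)) A"
  using assms by (induction I rule: finite_induct) (auto intro: has_sum_add)

lemma summable_on_dominated_product:
  fixes f :: "'a \<Rightarrow> 'b \<Rightarrow> 'c::banach"
  assumes "g summable_on UNIV" "h summable_on UNIV" "\<And>x y. norm (f x y) \<le> g x * h y"
    and "\<And>x. (g x :: real) \<ge> 0" "\<And>y. h y \<ge> 0"
  shows "(\<lambda>(x, y). f x y) summable_on UNIV \<times> UNIV"
proof -
  have "(\<lambda>x. norm (case x of (x, y) \<Rightarrow> g x * h y)) summable_on UNIV \<times> UNIV"
    unfolding Infinite_Sum.abs_summable_on_Sigma_iff
  proof (intro conjI ballI)
    show "(\<lambda>y. norm (case (x, y) of (x, y) \<Rightarrow> g x * h y)) summable_on UNIV" for x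
      using assms by (simp add: summable_on_cmult_right abs_mult)
    have "norm (\<Sum>\<^sub>\<infinity>y. norm (case (x, y) of (x, y) \<Rightarrow> g x * h y)) = g x * infsum h UNIV" for x
      using assms by (simp add: abs_mult infsum_cmult_right' infsum_nonneg)
    then show "(\<lambda>x. norm (\<Sum>\<^sub>\<infinity>y. norm (case (x, y) of (x, y) \<Rightarrow> g x * h y))) summable_on UNIV"
      using assms by (simp add: summable_on_cmult_left)
  qed
  then have "(\<lambda>(x, y). g x * h y) summable_on UNIV \<times> UNIV" by (rule abs_summable_summable)
  then have "(\<lambda>x. norm (case x of (x, y) \<Rightarrow> f x y)) summable_on UNIV \<times> UNIV"
    by (rule summable_on_comparison_test) (auto simp: assms)
  then show ?thesis by (rule abs_summable_summable)
qed

text \<open>The terms \<open>B^n / n!\<close> of the exponential series, with the factorial built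
  into the recursion.\<close>

primrec exp_term :: "zmat \<Rightarrow> nat \<Rightarrow> zmat" where
  "exp_term B 0 = mat_one"
| "exp_term B (Suc n) = (\<lambda>j k. 1 / of_nat (Suc n) * mat_mul B (exp_term B n) j k)"

definition mat_exp :: "zmat \<Rightarrow> zmat" where
  "mat_exp B j k = (\<Sum>n. exp_term B n j k)"

lemma exp_term_1: "exp_term B (Suc 0) = B"
  by (simp add: mat_mul_one_right)

context weights
begin

lemma bdd_by_scale:
  assumes "bdd_by w c A" "norm x \<le> e" "0 \<le> c" "\<And>j k. 0 \<le> w j k"
  shows "bdd_by w (e * c) (\<lambda>j k. x * A j k)"
  unfolding bdd_by_def
proof safe
  fix j k
  have "norm (x * A j k) \<le> e * (c * w j k)"
    unfolding norm_mult using assms order_trans[OF norm_ge_zero assms(2)]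
    by (intro mult_mono bdd_byD[OF assms(1)]) auto
  then show "norm (x * A j k) \<le> e * c * w j k" by (simp add: mult.assoc)
qed

lemma bdd_by_exp_term:
  assumes "0 \<le> b" "bdd_by (wW b) c B"
  shows "bdd_by (wW b) ((K * c) ^ n / fact n) (exp_term B n)"
proof (induction n)
  case (Suc n)
  have c: "0 \<le> c" using assms by (auto dest: bdd_by_nonneg)
  have "bdd_by (wW b) (1 / real (Suc n) * (K * c * ((K * c) ^ n / fact n))) (exp_term B (Suc n))"
    unfolding exp_term.simps using assms Suc c K_pos
    by (intro bdd_by_scale bdd_by_mat_mul_WW) (auto simp: w_nonneg norm_divide simp del: of_nat_Suc)
  also have "1 / real (Suc n) * (K * c * ((K * c) ^ n / fact n)) = (K * c) ^ Suc n / fact (Suc n)"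
    by (simp add: divide_simps)
  finally show ?case .
qed (simp add: bdd_by_mat_one)

text \<open>Two factors \<open>B\<close> in \<open>J\<close> are enough: the first carries the term
  of order \<open>n\<close> from the algebra into \<open>J\<close>, the second carries the result
  into \<open>T\<close>. The denominators \<open>n + 1\<close> and \<open>n + 2\<close> are
  estimated by 1.\<close>

lemma bdd_by_exp_term_T:
  assumes "0 \<le> b" "bdd_by (wW b) c B" "bdd_by (wJ b) d B"
  shows "bdd_by (wT b) (K * d * (K * d * ((K * c) ^ n / fact n))) (exp_term B (Suc (Suc n)))"
proof -
  have c: "0 \<le> c" "0 \<le> d" using assms by (auto dest: bdd_by_nonneg)
  have pos: "0 \<le> K * d * ((K * c) ^ n / fact n)" using c K_pos by auto
  then have pos': "0 \<le> K * d * (K * d * ((K * c) ^ n / fact n))" using c K_pos by auto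
  have le: "norm (1 / of_nat (Suc m) :: complex) \<le> 1" for m
    by (simp add: norm_divide del: of_nat_Suc)
  have "bdd_by (wJ b) (1 * (K * d * ((K * c) ^ n / fact n))) (exp_term B (Suc n))"
    unfolding exp_term.simps(2) by (intro bdd_by_scale bdd_by_mat_mul_JW bdd_by_exp_term assms le pos w_nonneg)
  then have "bdd_by (wT b) (1 * (K * d * (K * d * ((K * c) ^ n / fact n)))) (exp_term B (Suc (Suc n)))"
    unfolding exp_term.simps(2)[of _ "Suc n"]
    by (intro bdd_by_scale bdd_by_mat_mul_JJ assms le pos' w_nonneg) simp
  then show ?thesis by simp
qed

lemma inW_exp_term: "inW b B \<Longrightarrow> inW b (exp_term B n)"
  unfolding inW_def by (metis bdd_by_exp_term)

lemma inW_scale: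
  assumes "inW b B"
  shows "inW b (\<lambda>j k. x * B j k)"
proof -
  obtain c where c: "bdd_by (wW b) c B" "0 \<le> b" using assms by (auto simp: inW_def)
  have "bdd_by (wW b) (norm x * c) (\<lambda>j k. x * B j k)"
    using c(1) order_refl bdd_by_nonneg(1)[OF c(1)] w_nonneg(1) by (rule bdd_by_scale)
  then show ?thesis using c(2) by (auto simp: inW_def)
qed

text \<open>Normalised powers multiply with a binomial coefficient, by induction through
  associativity. The symmetry of the formula replaces a separate proof that powers of
  \<open>B\<close> commute.\<close>

lemma mat_mul_exp_term:
  assumes "inW b B"
  shows "mat_mul (exp_term B m) (exp_term B n) = (\<lambda>j k. of_nat ((m + n) choose m) * exp_term B (m + n) j k)"
proof (induction m arbitrary: n)
  case 0
  then show ?case by (simp add: mat_mul_one_left)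
next
  case (Suc m)
  show ?case
  proof (intro ext)
    fix j k
    have ch: "real (Suc (m + n)) * real ((m + n) choose m) = real (Suc m) * real (Suc (m + n) choose Suc m)"
      using Suc_times_binomial_eq[of "m + n" m] by (metis of_nat_mult mult.commute)
    have "mat_mul (exp_term B (Suc m)) (exp_term B n) j k
        = 1 / of_nat (Suc m) * mat_mul B (mat_mul (exp_term B m) (exp_term B n)) j k"
      unfolding exp_term.simps mat_mul_scale_left
      by (subst mat_mul_assoc[of b]) (auto intro: assms inW_exp_term)
    also have "\<dots> = 1 / of_nat (Suc m) * (of_nat ((m + n) choose m) * mat_mul B (exp_term B (m + n)) j k)"
      unfolding Suc mat_mul_scale_right ..
    also have "mat_mul B (exp_term B (m + n)) j k = of_nat (Suc (m + n)) * exp_term B (Suc (m + n)) j k"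
      by (simp del: of_nat_Suc)
    also have "1 / of_nat (Suc m) * (of_nat ((m + n) choose m) * (of_nat (Suc (m + n)) * exp_term B (Suc (m + n)) j k))
      = of_nat (Suc (m + n) choose Suc m) * exp_term B (Suc (m + n)) j k"
      using ch[THEN arg_cong[where f = complex_of_real]]
      by (simp add: divide_simps del: of_nat_Suc binomial_Suc_Suc exp_term.simps) (simp add: mult_ac)
    finally show "mat_mul (exp_term B (Suc m)) (exp_term B n) j k
        = of_nat (Suc m + n choose Suc m) * exp_term B (Suc m + n) j k" by simp
  qed
qed

lemma cnj_exp_term:
  assumes "inW b B" and skew: "\<And>j k. cnj (B j k) = - B k j"
  shows "cnj (exp_term B n l j) = (- 1) ^ n * exp_term B n j l"
proof (induction n arbitrary: l j)
  case 0
  then show ?case by (auto simp: mat_one_def)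
next
  case (Suc n)
  have "cnj (exp_term B (Suc n) l j) = 1 / of_nat (Suc n) * cnj (mat_mul B (exp_term B n) l j)"
    by simp
  also have "cnj (mat_mul B (exp_term B n) l j) = (\<Sum>\<^sub>\<infinity>m. (- 1) ^ Suc n * (exp_term B n j m * B m l))"
    unfolding mat_mul_def infsum_cnj[symmetric] complex_cnj_mult Suc skew
    by (simp add: mult_ac)
  \<comment> \<open>Taking the adjoint puts \<open>B\<close> on the right, while the recursion has
    it on the left; \<open>mat_mul_exp_term\<close> with second order 1 repairs this.\<close>
  also have "\<dots> = (- 1) ^ Suc n * mat_mul (exp_term B n) (exp_term B (Suc 0)) j l"
    unfolding infsum_cmult_right' mat_mul_def exp_term_1 ..
  also have "\<dots> = (- 1) ^ Suc n * (of_nat (Suc n) * exp_term B (Suc n) j l)"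
    unfolding mat_mul_exp_term[OF assms(1)] by simp
  also have "1 / of_nat (Suc n) * \<dots> = (- 1) ^ Suc n * exp_term B (Suc n) j l"
    by (simp del: of_nat_Suc exp_term.simps)
  finally show ?case .
qed

lemma summable_exp_term: "inW b B \<Longrightarrow> summable (\<lambda>n. norm (exp_term B n j k))"
proof -
  assume "inW b B"
  then obtain c where c: "bdd_by (wW b) c B" "0 \<le> b" by (auto simp: inW_def)
  have "summable (\<lambda>n. (K * c) ^ n / fact n * wW b j k)"
    using summable_exp[of "K * c"] by (intro summable_mult2) (simp add: field_simps)
  then show ?thesis
    by (rule summable_norm_comparison_test[rotated]) (intro exI allI impI bdd_byD[OF bdd_by_exp_term] c)
qed

lemmas summable_exp_term' = summable_norm_cancel[OF summable_exp_term]

text \<open>For skew-adjoint \<open>B\<close> the adjoint of the exponential is the exponential of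
  \<open>- B\<close>. The product is a double series over the intermediate index \<open>l\<close>
  and the total order \<open>N\<close>: summing over \<open>N\<close> first gives a Cauchy product,
  summing over \<open>l\<close> first gives an alternating binomial sum, which vanishes unless
  \<open>N = 0\<close>.\<close>

lemma mat_exp_adj_has_sum:
  assumes "inW b B" and skew: "\<And>j k. cnj (B j k) = - B k j"
  shows "((\<lambda>l. cnj (mat_exp B l j) * mat_exp B l k) has_sum mat_one j k) UNIV"
proof -
  obtain c where c: "bdd_by (wW b) c B" and b: "0 \<le> b" using assms(1) by (auto simp: inW_def)
  have c0: "0 \<le> c" using c by (rule bdd_by_nonneg)
  define e where "e n = (K * c) ^ n / fact n" for n
  have e0: "0 \<le> e n" for n using c0 K_pos by (simp add: e_def)
  have e_sum: "summable e" unfolding e_def using summable_exp[of "K * c"] by (simp add: field_simps)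
  \<comment> \<open>\<open>E N\<close> majorises the terms of total order \<open>N\<close>, so the
    double family is dominated by a function of \<open>l\<close> times a function of
    \<open>N\<close>.\<close>
  define E where "E N = (\<Sum>i\<le>N. e i * e (N - i))" for N
  have E0: "0 \<le> E N" for N unfolding E_def by (intro sum_nonneg mult_nonneg_nonneg e0)
  have "summable E"
    unfolding E_def using e_sum e0 by (intro summable_Cauchy_product) auto
  then have E_sum: "E summable_on UNIV"
    using E0 by (intro summable_nonneg_imp_summable_on) auto
  have t_le: "norm (exp_term B n l k) \<le> e n * wW b l k" for n l k
    unfolding e_def by (intro bdd_byD bdd_by_exp_term b c)
  define a where "a l N = (\<Sum>i\<le>N. (- 1) ^ i * exp_term B i j l * exp_term B (N - i) l k)" for l N
  have a_le: "norm (a l N) \<le> (wW b j l * wW b l k) * E N" for l N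
  proof -
    have "norm (a l N) \<le> (\<Sum>i\<le>N. norm ((- 1) ^ i * exp_term B i j l * exp_term B (N - i) l k))"
      unfolding a_def by (rule norm_sum)
    also have "\<dots> \<le> (\<Sum>i\<le>N. (e i * wW b j l) * (e (N - i) * wW b l k))"
      by (intro sum_mono) (simp add: norm_mult norm_power mult_mono t_le e0 w_nonneg)
    also have "\<dots> = (wW b j l * wW b l k) * E N"
      unfolding E_def sum_distrib_left by (rule sum.cong) (simp_all only: mult_ac)
    finally show ?thesis .
  qed
  have w_sum: "(\<lambda>l. wW b j l * wW b l k) summable_on UNIV"
    unfolding wW_def using alpha b by (intro kern_conv_summable) auto
  have a_sum: "(\<lambda>(l, N). a l N) summable_on UNIV \<times> UNIV"
    using w_sum E_sum a_le by (rule summable_on_dominated_product) (auto simp: w_nonneg E0)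
  have row: "((\<lambda>N. a l N) has_sum cnj (mat_exp B l j) * mat_exp B l k) UNIV" for l
  proof (rule norm_summable_imp_has_sum)
    have "summable (\<lambda>N. (wW b j l * wW b l k) * E N)" using \<open>summable E\<close> by (rule summable_mult)
    then show "summable (\<lambda>N. norm (a l N))"
      by (rule summable_norm_comparison_test[rotated]) (intro exI allI impI a_le)
    have "(\<lambda>n. cnj (exp_term B n l j)) sums cnj (mat_exp B l j)"
      unfolding mat_exp_def sums_cnj
      by (intro summable_sums summable_exp_term'[OF assms(1)])
    then have adj: "(\<Sum>n. (- 1) ^ n * exp_term B n j l) = cnj (mat_exp B l j)"
      unfolding cnj_exp_term[OF assms] by (rule sums_unique[symmetric])
    have "(\<lambda>N. \<Sum>i\<le>N. ((- 1) ^ i * exp_term B i j l) * exp_term B (N - i) l k) sums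
        ((\<Sum>n. (- 1) ^ n * exp_term B n j l) * (\<Sum>n. exp_term B n l k))"
      using summable_exp_term[OF assms(1)]
      by (intro Cauchy_product_sums) (auto simp: norm_mult norm_power)
    then show "(\<lambda>N. a l N) sums (cnj (mat_exp B l j) * mat_exp B l k)"
      unfolding a_def adj by (simp only: mat_exp_def)
  qed
  have col: "(\<Sum>\<^sub>\<infinity>l. a l N) = (if N = 0 then mat_one j k else 0)" for N
  proof -
    have "(\<Sum>\<^sub>\<infinity>l. a l N) = (\<Sum>i\<le>N. \<Sum>\<^sub>\<infinity>l. (- 1) ^ i * exp_term B i j l * exp_term B (N - i) l k)"
      unfolding a_def mult.assoc
      by (intro infsumI has_sum_finite_sum has_sum_infsum summable_on_cmult_right
          inW_summable[OF inW_exp_term[OF assms(1)] inW_exp_term[OF assms(1)]]) simp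
    also have "\<dots> = (\<Sum>i\<le>N. (- 1) ^ i * mat_mul (exp_term B i) (exp_term B (N - i)) j k)"
      unfolding mat_mul_def mult.assoc infsum_cmult_right' ..
    also have "\<dots> = (\<Sum>i\<le>N. (- 1) ^ i * of_nat (N choose i)) * exp_term B N j k"
      unfolding mat_mul_exp_term[OF assms(1)] sum_distrib_right by (intro sum.cong) (auto simp: mult.assoc)
    also have "\<dots> = (if N = 0 then mat_one j k else 0)"
      by (simp add: choose_alternating_sum)
    finally show ?thesis .
  qed
  have "((\<lambda>(l, N). a l N) has_sum infsum (\<lambda>(l, N). a l N) (UNIV \<times> UNIV)) (UNIV \<times> UNIV)"
    using a_sum by simp
  then have "((\<lambda>l. cnj (mat_exp B l j) * mat_exp B l k) has_sum infsum (\<lambda>(l, N). a l N) (UNIV \<times> UNIV)) UNIV"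
    by (rule has_sum_SigmaD) (use row in auto)
  also have "infsum (\<lambda>(l, N). a l N) (UNIV \<times> UNIV) = (\<Sum>\<^sub>\<infinity>l. \<Sum>\<^sub>\<infinity>N. a l N)"
    using infsum_Sigma'_banach[OF a_sum] by simp
  also have "\<dots> = (\<Sum>\<^sub>\<infinity>N. \<Sum>\<^sub>\<infinity>l. a l N)"
    using a_sum by (rule infsum_swap_banach)
  also have "\<dots> = (\<Sum>\<^sub>\<infinity>N::nat. if N = 0 then mat_one j k else 0)"
    unfolding col ..
  also have "\<dots> = mat_one j k"
    by (subst infsum_single_point[where a = 0]) auto
  finally show ?thesis .
qed

lemma cnj_mat_exp:
  assumes "inW b B" and skew: "\<And>j k. cnj (B j k) = - B k j"
  shows "cnj (mat_exp B l j) = mat_exp (\<lambda>j k. - B j k) j l"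
proof -
  have *: "exp_term (\<lambda>j k. - B j k) n = (\<lambda>j k. (- 1) ^ n * exp_term B n j k)" for n
  proof (induction n)
    case (Suc n)
    show ?case
      unfolding exp_term.simps(2) Suc mat_mul_uminus_left mat_mul_scale_right by simp
  qed simp
  have "(\<lambda>n. cnj (exp_term B n l j)) sums cnj (mat_exp B l j)"
    unfolding mat_exp_def sums_cnj
    by (intro summable_sums summable_exp_term'[OF assms(1)])
  then have "(\<Sum>n. (- 1) ^ n * exp_term B n j l) = cnj (mat_exp B l j)"
    unfolding cnj_exp_term[OF assms] by (rule sums_unique[symmetric])
  then show ?thesis unfolding mat_exp_def[of "\<lambda>j k. - B j k"] * by simp
qed

text \<open>The second orthogonality relation is the first one applied to
  \<open>- B\<close>.\<close>

lemma unitary_mat_exp: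
  assumes "inW b B" and skew: "\<And>j k. cnj (B j k) = - B k j"
  shows "unitary_mat (mat_exp B)"
proof -
  have m: "inW b (\<lambda>j k. - B j k)" using inW_scale[OF assms(1), of "-1"] by simp
  have "cnj (mat_exp (\<lambda>j k. - B j k) l j) = mat_exp B j l" for l j
    using cnj_mat_exp[OF m] skew by simp
  then have "((\<lambda>l. mat_exp B j l * cnj (mat_exp B k l)) has_sum mat_one j k) UNIV" for j k
    using mat_exp_adj_has_sum[OF m, of j k] skew cnj_mat_exp[OF assms, of k] by simp
  then show ?thesis
    using mat_exp_adj_has_sum[OF assms] by (simp add: unitary_mat_def mat_one_def)
qed

text \<open>From order two on, the series lies in \<open>T\<close> term by term by
  \<open>bdd_by_exp_term_T\<close>, and the constants sum to an exponential. The 2 in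
  \<open>d * 2\<close> is the factor from \<open>wJ_le_wW\<close>.\<close>

lemma bdd_by_mat_exp:
  assumes "0 \<le> b" and J: "bdd_by (wJ b) d B"
  shows "bdd_by (wT b) (K * d * (K * d * exp (K * (d * 2)))) (\<lambda>j k. mat_exp B j k - mat_one j k - B j k)"
  unfolding bdd_by_def
proof safe
  fix j k
  have d: "0 \<le> d" using J by (rule bdd_by_nonneg)
  have W: "bdd_by (wW b) (d * 2) B" using J d wJ_le_wW by (rule bdd_by_mono)
  then have inW: "inW b B" using assms by (auto simp: inW_def)
  let ?r = "\<lambda>n. K * d * (K * d * ((K * (d * 2)) ^ n / fact n)) * wT b j k"
  have "(\<lambda>n. (K * (d * 2)) ^ n / fact n) sums exp (K * (d * 2))"
    using exp_converges[of "K * (d * 2)"] by (simp add: field_simps)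
  then have r: "?r sums (K * d * (K * d * exp (K * (d * 2))) * wT b j k)"
    by (intro sums_mult sums_mult2)
  have le: "norm (exp_term B (Suc (Suc n)) j k) \<le> ?r n" for n
    by (intro bdd_byD bdd_by_exp_term_T W J assms)
  have "mat_exp B j k = (\<Sum>n. exp_term B (n + 2) j k) + (\<Sum>n<2. exp_term B n j k)"
    unfolding mat_exp_def
    by (intro suminf_split_initial_segment summable_exp_term'[OF inW])
  then have "mat_exp B j k - mat_one j k - B j k = (\<Sum>n. exp_term B (Suc (Suc n)) j k)"
    by (simp add: eval_nat_numeral mat_mul_one_right)
  moreover have "norm (\<Sum>n. exp_term B (Suc (Suc n)) j k) \<le> suminf ?r"
    using le r by (intro norm_suminf_le) (auto simp: sums_iff)
  ultimately show "norm (mat_exp B j k - mat_one j k - B j k) \<le> K * d * (K * d * exp (K * (d * 2))) * wT b j k"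
    using r by (simp add: sums_iff)
qed

end

section \<open>Time-dependent families with uniform bounds\<close>

text \<open>Termwise differentiation. The integers are enumerated by \<open>int_decode\<close> in
  order to use the theorem on series indexed by naturals; the majorant \<open>M\<close> gives
  uniform convergence of the derivatives by the Weierstrass test.\<close>

lemma has_vector_derivative_infsum_int:
  fixes f :: "int \<Rightarrow> real \<Rightarrow> 'b::banach"
  assumes "convex S" "t \<in> S"
    and der: "\<And>l s. s \<in> S \<Longrightarrow> (f l has_vector_derivative f' l s) (at s within S)"
    and le: "\<And>l s. s \<in> S \<Longrightarrow> norm (f' l s) \<le> M l" and M: "M summable_on UNIV"
    and f: "\<And>s. s \<in> S \<Longrightarrow> (\<lambda>l. norm (f l s)) summable_on UNIV"
  shows "((\<lambda>s. \<Sum>\<^sub>\<infinity>l. f l s) has_vector_derivative (\<Sum>\<^sub>\<infinity>l. f' l t)) (at t within S)"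
proof -
  note reindex = infsum_reindex_bij_betw[OF bij_int_decode, symmetric]
    and reindex_s = summable_on_reindex_bij_betw[OF bij_int_decode]
  have f'_s: "(\<lambda>l. norm (f' l s)) summable_on UNIV" if "s \<in> S" for s
    using M by (rule summable_on_comparison_test) (auto simp: le that)
  have sums_infsum: "(\<lambda>n. g (int_decode n)) sums (\<Sum>\<^sub>\<infinity>l. g l)"
    if "(\<lambda>l. norm (g l)) summable_on UNIV" for g :: "int \<Rightarrow> 'b"
  proof -
    have "(g \<circ> int_decode) summable_on UNIV"
      using abs_summable_summable[OF that] reindex_s[of g] by (simp add: o_def)
    then show ?thesis
      unfolding reindex[of g] by (intro has_sum_imp_sums has_sum_infsum) (simp add: o_def)
  qed
  have "(\<lambda>n. M (int_decode n)) summable_on UNIV" using M reindex_s[of M] by simp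
  then have "summable (\<lambda>n. M (int_decode n))" by (rule summable_on_imp_summable)
  then have ul: "uniform_limit S (\<lambda>n s. \<Sum>i<n. f' (int_decode i) s) (\<lambda>s. \<Sum>i. f' (int_decode i) s) sequentially"
    by (rule Weierstrass_m_test[rotated]) (rule le)
  have suminf_eq: "(\<Sum>i. f' (int_decode i) s) = (\<Sum>\<^sub>\<infinity>l. f' l s)" if "s \<in> S" for s
    using sums_infsum[OF f'_s[OF that]] by (rule sums_unique[symmetric])
  have ev: "\<forall>\<^sub>F n in sequentially. \<forall>s\<in>S. \<forall>h. norm ((\<Sum>i<n. h *\<^sub>R f' (int_decode i) s) - h *\<^sub>R (\<Sum>\<^sub>\<infinity>l. f' l s)) \<le> e * norm h"
    if "e > 0" for e
    using uniform_limitD[OF ul that]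
  proof eventually_elim
    case (elim n)
    show ?case
    proof (intro ballI allI)
      fix s and h :: real
      assume "s \<in> S"
      have "norm ((\<Sum>i<n. h *\<^sub>R f' (int_decode i) s) - h *\<^sub>R (\<Sum>\<^sub>\<infinity>l. f' l s))
          = \<bar>h\<bar> * norm ((\<Sum>i<n. f' (int_decode i) s) - (\<Sum>\<^sub>\<infinity>l. f' l s))"
        by (simp flip: scaleR_sum_right scaleR_diff_right)
      also have "\<dots> \<le> \<bar>h\<bar> * e"
        using elim[rule_format, OF \<open>s \<in> S\<close>] suminf_eq[OF \<open>s \<in> S\<close>]
        by (intro mult_left_mono) (auto simp: dist_norm)
      finally show "norm ((\<Sum>i<n. h *\<^sub>R f' (int_decode i) s) - h *\<^sub>R (\<Sum>\<^sub>\<infinity>l. f' l s)) \<le> e * norm h"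
        by (simp add: mult.commute)
    qed
  qed
  have "\<exists>g. \<forall>s\<in>S. (\<lambda>n. f (int_decode n) s) sums g s \<and>
      (g has_derivative (\<lambda>h. h *\<^sub>R (\<Sum>\<^sub>\<infinity>l. f' l s))) (at s within S)"
    using der unfolding has_vector_derivative_def
    by (intro has_derivative_series[where f' = "\<lambda>n s h. h *\<^sub>R f' (int_decode n) s", OF assms(1) _ ev assms(2) sums_infsum[OF f]])
       (auto simp: assms(2))
  then obtain g where g: "\<And>s. s \<in> S \<Longrightarrow> (\<lambda>n. f (int_decode n) s) sums g s"
      "\<And>s. s \<in> S \<Longrightarrow> (g has_vector_derivative (\<Sum>\<^sub>\<infinity>l. f' l s)) (at s within S)"
    unfolding has_vector_derivative_def by blast
  have "g s = (\<Sum>\<^sub>\<infinity>l. f l s)" if "s \<in> S" for s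
    using g(1)[OF that] sums_infsum[OF f[OF that]] by (rule sums_unique2)
  then show ?thesis
    using has_vector_derivative_transform[OF assms(2) _ g(2)[OF assms(2)], of "\<lambda>s. \<Sum>\<^sub>\<infinity>l. f l s"] by simp
qed

lemma norm_diff_le_of_vector_derivative:
  fixes f :: "real \<Rightarrow> 'b::real_normed_vector"
  assumes "convex S" "x \<in> S" "y \<in> S"
    and "\<And>s. s \<in> S \<Longrightarrow> (f has_vector_derivative f' s) (at s within S)"
    and "\<And>s. s \<in> S \<Longrightarrow> norm (f' s) \<le> B"
  shows "norm (f x - f y) \<le> B * \<bar>x - y\<bar>"
proof -
  have "norm (f x - f y) \<le> B * norm (x - y)"
  proof (rule differentiable_bound[OF assms(1) _ _ assms(2,3)])
    show "(f has_derivative (\<lambda>h. h *\<^sub>R f' s)) (at s within S)" if "s \<in> S" for s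
      using assms(4)[OF that] by (simp add: has_vector_derivative_def)
    show "onorm (\<lambda>h. h *\<^sub>R f' s) \<le> B" if "s \<in> S" for s
    proof (rule onorm_le)
      fix h :: real
      show "norm (h *\<^sub>R f' s) \<le> B * norm h"
        using mult_left_mono[OF assms(5)[OF that], of "\<bar>h\<bar>"] by (simp add: mult.commute)
    qed
  qed
  then show ?thesis by simp
qed

text \<open>The final constant may depend on neither \<open>\<beta>\<close> nor the potential, so every bound below is uniform
  over a parameter set \<open>\<Omega>\<close>, which the theorem instantiates with all admissible triples \<open>(\<beta>, v, W)\<close>.\<close>

locale weighted_family = weights \<alpha> for \<alpha> +
  fixes \<Omega> :: "'q set" and \<beta> :: "'q \<Rightarrow> real"
  assumes beta_nonneg: "q \<in> \<Omega> \<Longrightarrow> 0 \<le> \<beta> q"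
begin

definition I :: "real set" where "I = {0..2*pi}"

lemma I_facts: "0 \<in> I" "2 * pi \<in> I" "convex I"
  by (auto simp: I_def)

definition bigO :: "(real \<Rightarrow> int \<Rightarrow> int \<Rightarrow> real) \<Rightarrow> ('q \<Rightarrow> real \<Rightarrow> zmat) \<Rightarrow> bool" where
  "bigO w F \<longleftrightarrow> (\<exists>c\<ge>0. \<forall>q\<in>\<Omega>. \<forall>t\<in>I. bdd_by (w (\<beta> q)) c (F q t))"

lemma bigOI:
  assumes "0 \<le> c" "\<And>q t j k. q \<in> \<Omega> \<Longrightarrow> t \<in> I \<Longrightarrow> norm (F q t j k) \<le> c * w (\<beta> q) j k"
  shows "bigO w F"
  unfolding bigO_def bdd_by_def using assms by blast

lemma bigOE:
  assumes "bigO w F"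
  obtains c where "0 \<le> c" "\<And>q t. q \<in> \<Omega> \<Longrightarrow> t \<in> I \<Longrightarrow> bdd_by (w (\<beta> q)) c (F q t)"
  using assms unfolding bigO_def by blast

lemma bigO_dominated:
  assumes "bigO w F" "0 \<le> C"
    and "\<And>q t j k. q \<in> \<Omega> \<Longrightarrow> t \<in> I \<Longrightarrow> norm (G q t j k) \<le> C * norm (F q t j k)"
  shows "bigO w G"
proof -
  obtain c where c: "0 \<le> c" "\<And>q t. q \<in> \<Omega> \<Longrightarrow> t \<in> I \<Longrightarrow> bdd_by (w (\<beta> q)) c (F q t)"
    using assms(1) unfolding bigO_def by blast
  show ?thesis
  proof (rule bigOI)
    fix q t j k assume "q \<in> \<Omega>" "t \<in> I"
    then have "norm (G q t j k) \<le> C * (c * w (\<beta> q) j k)"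
      using assms c by (intro order_trans[OF assms(3)] mult_left_mono bdd_byD) auto
    then show "norm (G q t j k) \<le> (C * c) * w (\<beta> q) j k" by (simp add: mult.assoc)
  qed (use c assms in auto)
qed

lemma bigO_cong:
  assumes "bigO w F" "\<And>q t j k. q \<in> \<Omega> \<Longrightarrow> t \<in> I \<Longrightarrow> G q t j k = F q t j k"
  shows "bigO w G"
  using assms(1) by (rule bigO_dominated[where C = 1]) (auto simp: assms(2))

lemma bigO_scale: "bigO w F \<Longrightarrow> bigO w (\<lambda>q t j k. x * F q t j k)"
  by (erule bigO_dominated[where C = "norm x"]) (auto simp: norm_mult)

lemma bigO_uminus: "bigO w F \<Longrightarrow> bigO w (\<lambda>q t j k. - F q t j k)"
  by (erule bigO_dominated[where C = 1]) auto

lemma bigO_at: "bigO w F \<Longrightarrow> t0 \<in> I \<Longrightarrow> bigO w (\<lambda>q t. F q t0)"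
  unfolding bigO_def by blast

lemma bigO_add:
  assumes "bigO w F" "bigO w G"
  shows "bigO w (\<lambda>q t j k. F q t j k + G q t j k)"
proof -
  obtain c d where c: "0 \<le> c" "\<And>q t. q \<in> \<Omega> \<Longrightarrow> t \<in> I \<Longrightarrow> bdd_by (w (\<beta> q)) c (F q t)"
    and d: "0 \<le> d" "\<And>q t. q \<in> \<Omega> \<Longrightarrow> t \<in> I \<Longrightarrow> bdd_by (w (\<beta> q)) d (G q t)"
    using assms unfolding bigO_def by blast
  show ?thesis
  proof (rule bigOI)
    fix q t j k assume *: "q \<in> \<Omega>" "t \<in> I"
    show "norm (F q t j k + G q t j k) \<le> (c + d) * w (\<beta> q) j k"
      using norm_triangle_mono[OF bdd_byD[OF c(2)[OF *]] bdd_byD[OF d(2)[OF *]], of j k j k]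
      by (simp add: distrib_right)
  qed (use c d in auto)
qed

lemma bigO_diff:
  assumes "bigO w F" "bigO w G"
  shows "bigO w (\<lambda>q t j k. F q t j k - G q t j k)"
  using bigO_add[OF assms(1) bigO_uminus[OF assms(2)]] by simp

lemma bigO_T_imp_J: "bigO wT F \<Longrightarrow> bigO wJ F"
  by (erule bigOE, rule bigOI) (auto intro: order_trans[OF bdd_byD] mult_left_mono wT_le_wJ)

lemma bigO_J_imp_W:
  assumes "bigO wJ F"
  shows "bigO wW F"
proof -
  obtain c where c: "0 \<le> c" "\<And>q t. q \<in> \<Omega> \<Longrightarrow> t \<in> I \<Longrightarrow> bdd_by (wJ (\<beta> q)) c (F q t)"
    using assms unfolding bigO_def by blast
  show ?thesis
    by (rule bigOI[where c = "c * 2"]) (use bdd_by_mono[OF c(2) c(1) wJ_le_wW] c(1) in \<open>auto dest: bdd_byD\<close>)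
qed

lemma bigO_T_imp_W: "bigO wT F \<Longrightarrow> bigO wW F"
  by (intro bigO_J_imp_W bigO_T_imp_J)

lemma bigO_mult_aux:
  assumes "bigO w1 F" "bigO w2 G"
    and "\<And>q c d A B. q \<in> \<Omega> \<Longrightarrow> bdd_by (w1 (\<beta> q)) c A \<Longrightarrow> bdd_by (w2 (\<beta> q)) d B
      \<Longrightarrow> bdd_by (w (\<beta> q)) (K * c * d) (mat_mul A B)"
  shows "bigO w (\<lambda>q t. mat_mul (F q t) (G q t))"
proof -
  obtain c d where "0 \<le> c" "\<And>q t. q \<in> \<Omega> \<Longrightarrow> t \<in> I \<Longrightarrow> bdd_by (w1 (\<beta> q)) c (F q t)"
    and "0 \<le> d" "\<And>q t. q \<in> \<Omega> \<Longrightarrow> t \<in> I \<Longrightarrow> bdd_by (w2 (\<beta> q)) d (G q t)"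
    using assms(1,2) unfolding bigO_def by blast
  then show ?thesis
    using assms(3) K_pos unfolding bigO_def by (intro exI[of _ "K * c * d"]) auto
qed

lemma bigO_WW: "bigO wW F \<Longrightarrow> bigO wW G \<Longrightarrow> bigO wW (\<lambda>q t. mat_mul (F q t) (G q t))"
  by (erule (1) bigO_mult_aux) (intro bdd_by_mat_mul_WW beta_nonneg)

lemma bigO_inW: "bigO wW F \<Longrightarrow> q \<in> \<Omega> \<Longrightarrow> t \<in> I \<Longrightarrow> inW (\<beta> q) (F q t)"
  using beta_nonneg unfolding bigO_def inW_def by blast

lemma bigO_summable:
  assumes "bigO wW F" "bigO wW G" "q \<in> \<Omega>" "t \<in> I"
  shows "(\<lambda>l. norm (F q t j l * G q t l k)) summable_on UNIV"
  using assms bigO_inW inW_abs_summable by metis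

lemma bigO_WJ: "bigO wW F \<Longrightarrow> bigO wJ G \<Longrightarrow> bigO wJ (\<lambda>q t. mat_mul (F q t) (G q t))"
  by (erule (1) bigO_mult_aux) (intro bdd_by_mat_mul_WJ beta_nonneg)

lemma bigO_JW: "bigO wJ F \<Longrightarrow> bigO wW G \<Longrightarrow> bigO wJ (\<lambda>q t. mat_mul (F q t) (G q t))"
  by (erule (1) bigO_mult_aux) (intro bdd_by_mat_mul_JW beta_nonneg)

lemma bigO_JJ: "bigO wJ F \<Longrightarrow> bigO wJ G \<Longrightarrow> bigO wT (\<lambda>q t. mat_mul (F q t) (G q t))"
  by (erule (1) bigO_mult_aux) (intro bdd_by_mat_mul_JJ beta_nonneg)

lemma bigO_WT: "bigO wW F \<Longrightarrow> bigO wT G \<Longrightarrow> bigO wT (\<lambda>q t. mat_mul (F q t) (G q t))"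
  by (erule (1) bigO_mult_aux) (intro bdd_by_mat_mul_WT beta_nonneg)

lemma bigO_TW: "bigO wT F \<Longrightarrow> bigO wW G \<Longrightarrow> bigO wT (\<lambda>q t. mat_mul (F q t) (G q t))"
  by (erule (1) bigO_mult_aux) (intro bdd_by_mat_mul_TW beta_nonneg)

lemma bigO_one: "bigO wW (\<lambda>q t. mat_one)"
  unfolding bigO_def using bdd_by_mat_one by (intro exI[of _ 1]) auto

definition has_deriv :: "('q \<Rightarrow> real \<Rightarrow> zmat) \<Rightarrow> ('q \<Rightarrow> real \<Rightarrow> zmat) \<Rightarrow> bool" where
  "has_deriv F F' \<longleftrightarrow> (\<forall>q\<in>\<Omega>. \<forall>t\<in>I. \<forall>j k. ((\<lambda>s. F q s j k) has_vector_derivative F' q t j k) (at t within I))"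

text \<open>Differentiation under the sum over \<open>l\<close>: the uniform bounds on the four
  families give a constant times \<open>wW (\<beta> q) j l * wW (\<beta> q) l k\<close> as a
  majorant independent of time.\<close>

lemma has_deriv_mat_mul:
  assumes O: "bigO wW F" "bigO wW F'" "bigO wW G" "bigO wW G'"
    and F: "has_deriv F F'" and G: "has_deriv G G'"
  shows "has_deriv (\<lambda>q t. mat_mul (F q t) (G q t))
    (\<lambda>q t j k. mat_mul (F' q t) (G q t) j k + mat_mul (F q t) (G' q t) j k)"
  unfolding has_deriv_def
proof (intro ballI allI)
  fix q t j k assume qt: "q \<in> \<Omega>" "t \<in> I"
  obtain c1 where c1: "0 \<le> c1" "\<And>q t. q \<in> \<Omega> \<Longrightarrow> t \<in> I \<Longrightarrow> bdd_by (wW (\<beta> q)) c1 (F q t)" using O(1) unfolding bigO_def by blast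
  obtain c2 where c2: "0 \<le> c2" "\<And>q t. q \<in> \<Omega> \<Longrightarrow> t \<in> I \<Longrightarrow> bdd_by (wW (\<beta> q)) c2 (F' q t)" using O(2) unfolding bigO_def by blast
  obtain c3 where c3: "0 \<le> c3" "\<And>q t. q \<in> \<Omega> \<Longrightarrow> t \<in> I \<Longrightarrow> bdd_by (wW (\<beta> q)) c3 (G q t)" using O(3) unfolding bigO_def by blast
  obtain c4 where c4: "0 \<le> c4" "\<And>q t. q \<in> \<Omega> \<Longrightarrow> t \<in> I \<Longrightarrow> bdd_by (wW (\<beta> q)) c4 (G' q t)" using O(4) unfolding bigO_def by blast
  let ?w = "\<lambda>l. wW (\<beta> q) j l * wW (\<beta> q) l k"
  let ?f' = "\<lambda>l s. F' q s j l * G q s l k + F q s j l * G' q s l k"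
  have w: "?w summable_on UNIV"
    unfolding wW_def using alpha beta_nonneg qt by (intro kern_conv_summable) auto
  have "((\<lambda>s. \<Sum>\<^sub>\<infinity>l. F q s j l * G q s l k) has_vector_derivative (\<Sum>\<^sub>\<infinity>l. ?f' l t)) (at t within I)"
  proof (rule has_vector_derivative_infsum_int[OF I_facts(3) qt(2)])
    fix l s assume s: "s \<in> I"
    show "((\<lambda>s. F q s j l * G q s l k) has_vector_derivative ?f' l s) (at s within I)"
      using F G qt s unfolding has_deriv_def
      by (subst add.commute) (intro has_vector_derivative_mult, auto)
    have "norm (?f' l s) \<le> (c2 * wW (\<beta> q) j l) * (c3 * wW (\<beta> q) l k) + (c1 * wW (\<beta> q) j l) * (c4 * wW (\<beta> q) l k)"
      using c1 c2 c3 c4 qt s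
      by (intro norm_triangle_mono; unfold norm_mult; intro mult_mono bdd_byD) (auto simp: w_nonneg)
    then show "norm (?f' l s) \<le> (c2 * c3 + c1 * c4) * ?w l" by (simp add: algebra_simps)
  qed (use w O qt in \<open>auto intro: summable_on_cmult_right bigO_summable\<close>)
  also have "(\<Sum>\<^sub>\<infinity>l. ?f' l t) = mat_mul (F' q t) (G q t) j k + mat_mul (F q t) (G' q t) j k"
    unfolding mat_mul_def
    by (intro infsum_add abs_summable_summable[OF bigO_summable] O qt)
  finally show "((\<lambda>s. mat_mul (F q s) (G q s) j k) has_vector_derivative
      mat_mul (F' q t) (G q t) j k + mat_mul (F q t) (G' q t) j k) (at t within I)"
    by (simp add: mat_mul_def)
qed

text \<open>The mean value inequality in each entry shows that integration in time stays in the
  class of the derivative; the length of \<open>I\<close> enters only the constant.\<close>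

lemma bigO_increment:
  assumes "bigO w F'" "has_deriv F F'" and w: "\<And>b j k. 0 \<le> w b j k"
  shows "bigO w (\<lambda>q t j k. F q t j k - F q 0 j k)"
proof -
  obtain c where c: "0 \<le> c" "\<And>q t. q \<in> \<Omega> \<Longrightarrow> t \<in> I \<Longrightarrow> bdd_by (w (\<beta> q)) c (F' q t)"
    using assms(1) unfolding bigO_def by blast
  show ?thesis
  proof (rule bigOI)
    fix q t j k assume qt: "q \<in> \<Omega>" "t \<in> I"
    have "norm (F q t j k - F q 0 j k) \<le> c * w (\<beta> q) j k * \<bar>t - 0\<bar>"
      using assms(2) qt unfolding has_deriv_def
      by (intro norm_diff_le_of_vector_derivative[OF I_facts(3) qt(2) I_facts(1), where f' = "\<lambda>t. F' q t j k"] bdd_byD c) auto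
    also have "\<dots> \<le> c * w (\<beta> q) j k * (2 * pi)"
      using qt c w by (intro mult_left_mono) (auto simp: I_def)
    finally show "norm (F q t j k - F q 0 j k) \<le> (2 * pi * c) * w (\<beta> q) j k" by (simp add: mult_ac)
  qed (use c in auto)
qed

end

section \<open>The propagator in the interaction picture\<close>

text \<open>Needed for the part of the a priori bound on the propagator that does not decay away
  from the diagonal.\<close>

lemma kern_sum:
  assumes "a > 1" "b \<ge> 0"
  shows "(\<lambda>l. kern a b j l) summable_on UNIV" and "(\<Sum>\<^sub>\<infinity>l. kern a b j l) \<le> conv_const a"
proof -
  note s = summable_on_jbr_powr[OF assms(1)]
  have bj: "bij (\<lambda>l. j - l)"
    by (auto intro!: bijI' intro: exI[of _ "j - _"])
  have s1: "(\<lambda>l. 1 / jbr (j - l) powr a) summable_on UNIV"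
    using summable_on_reindex_bij_betw[OF bj, of "\<lambda>l. 1 / jbr l powr a"] s by simp
  have e1: "(\<Sum>\<^sub>\<infinity>l. 1 / jbr (j - l) powr a) = (\<Sum>\<^sub>\<infinity>l. 1 / jbr l powr a)"
    using infsum_reindex_bij_betw[OF bj, of "\<lambda>l. 1 / jbr l powr a"] by simp
  have le: "kern a b j l \<le> 1 / jbr (j - l) powr a" for l
    unfolding kern_def using assms by (intro divide_right_mono) auto
  show sm: "(\<lambda>l. kern a b j l) summable_on UNIV"
    using s1 by (rule summable_on_comparison_test) (auto simp: le kern_nonneg)
  have "(\<Sum>\<^sub>\<infinity>l. kern a b j l) \<le> (\<Sum>\<^sub>\<infinity>l. 1 / jbr l powr a)"
    unfolding e1[symmetric] by (intro infsum_mono sm s1 le)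
  also have "\<dots> \<le> conv_const a"
  proof -
    have "1 * 1 \<le> 2 * 2 powr a" using assms by (intro mult_mono ge_one_powr_ge_zero) auto
    then have "1 * (\<Sum>\<^sub>\<infinity>l. 1 / jbr l powr a) \<le> 2 * 2 powr a * (\<Sum>\<^sub>\<infinity>l. 1 / jbr l powr a)"
      by (intro mult_right_mono infsum_nonneg) auto
    then show ?thesis by (simp add: conv_const_def)
  qed
  finally show "(\<Sum>\<^sub>\<infinity>l. kern a b j l) \<le> conv_const a" .
qed

lemma unitary_mat_norm_le_1:
  assumes "unitary_mat U"
  shows "norm (U j k) \<le> 1"
proof -
  have "((\<lambda>l. cnj (U l k) * U l k) has_sum 1) UNIV"
    using assms[unfolded unitary_mat_def, THEN conjunct1, rule_format, of k k] by simp
  from has_sum_Re[OF this] have "((\<lambda>l. Re (cnj (U l k) * U l k)) has_sum 1) UNIV" by simp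
  moreover have "Re (cnj z * z) = (norm z)\<^sup>2" for z
    by (simp add: cmod_power2) (simp add: power2_eq_square)
  ultimately have "((\<lambda>l. (norm (U l k))\<^sup>2) has_sum 1) UNIV" by simp
  then have "(\<Sum>l\<in>{j}. (norm (U l k))\<^sup>2) \<le> 1"
    by (intro finite_sum_le_has_sum[where A = UNIV and f = "\<lambda>l. (norm (U l k))\<^sup>2"]) auto
  then show ?thesis using power2_le_imp_le[of "norm (U j k)" 1] by simp
qed

text \<open>With \<open>m = j^2\<close> this is the inverse of the free flow in mode
  \<open>j\<close>.\<close>

definition osc :: "real \<Rightarrow> real \<Rightarrow> int \<Rightarrow> complex" where
  "osc h t m = exp (of_real t * (\<i> * of_int m / of_real h))"

lemma osc_eq_cis: "osc h t m = cis (t * of_int m / h)"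
  by (simp add: osc_def cis_conv_exp field_simps)

lemma norm_osc: "norm (osc h t m) = 1"
  by (simp add: osc_eq_cis)

lemma osc_add: "osc h t (m + n) = osc h t m * osc h t n"
  by (simp add: osc_def exp_add[symmetric] algebra_simps add_divide_distrib)

lemma osc_0: "osc h t 0 = 1" "osc h 0 m = 1"
  by (simp_all add: osc_def)

lemma has_vector_derivative_osc:
  "((\<lambda>t. osc h t m) has_vector_derivative (\<i> * of_int m / of_real h) * osc h t m) (at t within S)"
proof -
  have "((\<lambda>z. exp (z * c)) has_field_derivative c * exp (of_real t * c)) (at (of_real t))" for c :: complex
    by (auto intro!: derivative_eq_intros)
  then show ?thesis unfolding osc_def by (rule has_vector_derivative_real_field)
qed

definition phase :: "real \<Rightarrow> real \<Rightarrow> zmat \<Rightarrow> zmat" where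
  "phase h t A j k = osc h t (j^2 - k^2) * A j k"

lemma norm_phase: "norm (phase h t A j k) = norm (A j k)"
  by (simp add: phase_def norm_mult norm_osc)

text \<open>The frequencies telescope, \<open>(j^2 - l^2) + (l^2 - k^2) = j^2 - k^2\<close>, so the
  phase leaves the sum over \<open>l\<close>.\<close>

lemma mat_mul_phase: "mat_mul (phase h t A) (phase h t B) = phase h t (mat_mul A B)"
proof (intro ext)
  fix j k
  have "phase h t A j l * phase h t B l k = osc h t (j^2 - k^2) * (A j l * B l k)" for l
    using osc_add[of h t "j^2 - l^2" "l^2 - k^2"] by (simp add: phase_def mult_ac)
  then show "mat_mul (phase h t A) (phase h t B) j k = phase h t (mat_mul A B) j k"
    by (simp only: mat_mul_def phase_def[of h t "mat_mul A B" j k] infsum_cmult_right')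
qed

text \<open>\<open>j^2 - k^2\<close> is the product of the nonzero integers \<open>j - k\<close> and
  \<open>j + k\<close>. Such a product has absolute value at least the sum of the two absolute
  values minus 1, and that sum is at least twice the larger of |j| and |k|.\<close>

lemma jbr_le_diff_squares:
  assumes "j^2 \<noteq> (k::int)^2"
  shows "max (jbr j) (jbr k) \<le> 2 * real_of_int \<bar>j^2 - k^2\<bar>"
proof -
  have sq: "j^2 - k^2 = (j - k) * (j + k)" by (simp add: power2_eq_square algebra_simps)
  have "j - k \<noteq> 0" "j + k \<noteq> 0" using sq assms by auto
  then have nz: "\<bar>j - k\<bar> \<ge> 1" "\<bar>j + k\<bar> \<ge> 1" by linarith+
  then have "(\<bar>j - k\<bar> - 1) * (\<bar>j + k\<bar> - 1) \<ge> 0" by simp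
  then have "\<bar>j - k\<bar> + \<bar>j + k\<bar> \<le> \<bar>j^2 - k^2\<bar> + 1"
    unfolding sq abs_mult by (simp add: algebra_simps)
  moreover have "2 * \<bar>j\<bar> \<le> \<bar>j - k\<bar> + \<bar>j + k\<bar>" "2 * \<bar>k\<bar> \<le> \<bar>j - k\<bar> + \<bar>j + k\<bar>" by linarith+
  ultimately have "\<bar>j\<bar> + 1 \<le> 2 * \<bar>j^2 - k^2\<bar>" "\<bar>k\<bar> + 1 \<le> 2 * \<bar>j^2 - k^2\<bar>"
    using nz by linarith+
  then have "real_of_int \<bar>j\<bar> + 1 \<le> 2 * real_of_int \<bar>j^2 - k^2\<bar>" "real_of_int \<bar>k\<bar> + 1 \<le> 2 * real_of_int \<bar>j^2 - k^2\<bar>"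
    by linarith+
  then show ?thesis unfolding jbr_def by (rule max.boundedI)
qed

text \<open>Off the resonant entries this inverts the commutator with the diagonal matrix of the
  \<open>k^2\<close>, as in the homological equation of averaging theory.\<close>

definition sqdiv :: "zmat \<Rightarrow> zmat" where
  "sqdiv A j k = A j k / of_int (j^2 - k^2)"

lemma norm_sqdiv_le: "norm (sqdiv A j k) \<le> norm (A j k) * (2 / max (jbr j) (jbr k))"
proof (cases "j^2 = k^2")
  case True
  then show ?thesis using jbr_nonneg[of j] by (auto simp: sqdiv_def)
next
  case False
  have pos: "0 < max (jbr j) (jbr k)" using jbr_pos[of j] by linarith
  have "inverse (real_of_int \<bar>j^2 - k^2\<bar>) \<le> 2 / max (jbr j) (jbr k)"
  proof -
    have "inverse y \<le> 2 / m" if "m \<le> 2 * y" "0 < m" for m y :: real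
      using that by (simp add: field_simps)
    then show ?thesis using jbr_le_diff_squares[OF False] pos .
  qed
  moreover have "norm (sqdiv A j k) = norm (A j k) * inverse (real_of_int \<bar>j^2 - k^2\<bar>)"
    by (simp only: sqdiv_def norm_mult norm_inverse norm_of_int divide_inverse of_int_abs)
  ultimately show ?thesis using mult_left_mono[OF _ norm_ge_zero[of "A j k"]] by metis
qed

context weighted_family
begin

lemma kern_le_kern_diff_1: "kern \<alpha> b j k \<le> kern (\<alpha> - 1) b j k"
  unfolding kern_diff_1 using mult_left_mono[OF jbr_ge_1 kern_nonneg] by simp

lemma bigO_sqdiv_W:
  assumes "bigO wW F"
  shows "bigO wJ (\<lambda>q t. sqdiv (F q t))"
proof -
  obtain c where c: "0 \<le> c" "\<And>q t. q \<in> \<Omega> \<Longrightarrow> t \<in> I \<Longrightarrow> bdd_by (wW (\<beta> q)) c (F q t)"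
    using assms unfolding bigO_def by blast
  show ?thesis
  proof (rule bigOI)
    fix q t j k assume qt: "q \<in> \<Omega>" "t \<in> I"
    have "norm (sqdiv (F q t) j k) \<le> (c * kern (\<alpha> - 1) (\<beta> q) j k) * (2 / max (jbr j) (jbr k))"
      using bdd_byD[OF c(2)[OF qt], of j k] mult_left_mono[OF kern_le_kern_diff_1 c(1)] max_jbr_pos[of j k]
      by (intro order_trans[OF norm_sqdiv_le] mult_right_mono) (auto simp: wW_def intro: order_trans)
    then show "norm (sqdiv (F q t) j k) \<le> (2 * c) * wJ (\<beta> q) j k"
      by (simp add: wJ_def mult_ac)
  qed (use c in auto)
qed

lemma bigO_sqdiv_J:
  assumes "bigO wJ F"
  shows "bigO wT (\<lambda>q t. sqdiv (F q t))"
proof -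
  obtain c where c: "0 \<le> c" "\<And>q t. q \<in> \<Omega> \<Longrightarrow> t \<in> I \<Longrightarrow> bdd_by (wJ (\<beta> q)) c (F q t)"
    using assms unfolding bigO_def by blast
  show ?thesis
  proof (rule bigOI)
    fix q t j k assume qt: "q \<in> \<Omega>" "t \<in> I"
    have m: "max (jbr j) (jbr k) * max (jbr j) (jbr k) \<ge> jbr j * jbr k"
      by (intro mult_mono) (auto simp: jbr_nonneg le_max_iff_disj)
    have "norm (sqdiv (F q t) j k) \<le> (c * wJ (\<beta> q) j k) * (2 / max (jbr j) (jbr k))"
      using bdd_byD[OF c(2)[OF qt], of j k] max_jbr_pos[of j k]
      by (intro order_trans[OF norm_sqdiv_le] mult_right_mono) auto
    also have "\<dots> = 2 * c * (kern (\<alpha> - 1) (\<beta> q) j k / (max (jbr j) (jbr k) * max (jbr j) (jbr k)))"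
      by (simp add: wJ_def)
    also have "\<dots> \<le> 2 * c * (kern (\<alpha> - 1) (\<beta> q) j k / (jbr j * jbr k))"
      using m c max_jbr_pos[of j k] jbr_pos
      by (intro mult_left_mono divide_left_mono kern_nonneg mult_pos_pos) auto
    finally show "norm (sqdiv (F q t) j k) \<le> (2 * c) * wT (\<beta> q) j k"
      by (simp add: wT_def)
  qed (use c in auto)
qed

text \<open>On the antidiagonal \<open>j - k = 2 * j\<close>, so one power of the bracket of
  \<open>j - k\<close> dominates the maximum in \<open>wJ\<close>. The gain comes from the decay of
  the kernel, not from oscillation.\<close>

lemma bigO_antidiag:
  assumes "bigO wW F"
  shows "bigO wJ (\<lambda>q t j k. if k = - j then F q t j k else 0)"
proof -
  obtain c where c: "0 \<le> c" "\<And>q t. q \<in> \<Omega> \<Longrightarrow> t \<in> I \<Longrightarrow> bdd_by (wW (\<beta> q)) c (F q t)"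
    using assms unfolding bigO_def by blast
  show ?thesis
  proof (rule bigOI)
    fix q t j k assume qt: "q \<in> \<Omega>" "t \<in> I"
    have "wW (\<beta> q) j (- j) \<le> wJ (\<beta> q) j (- j)"
    proof -
      have "max (jbr j) (jbr (- j)) \<le> jbr (j - (- j))" by (simp add: jbr_def)
      then show ?thesis
        unfolding wW_def wJ_def kern_diff_1
        using max_jbr_pos[of j "- j"] kern_pos[of \<alpha> "\<beta> q" j "- j"]
        by (simp add: pos_le_divide_eq mult_left_mono)
    qed
    then have "norm (F q t j (- j)) \<le> c * wJ (\<beta> q) j (- j)"
      using bdd_byD[OF c(2)[OF qt], of j "- j"] c(1) by (meson mult_left_mono order_trans)
    then show "norm (if k = - j then F q t j k else 0) \<le> c * wJ (\<beta> q) j k"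
      using c(1) by (auto simp: w_nonneg)
  qed (use c in auto)
qed

lemma bigO_phase: "bigO w F \<Longrightarrow> bigO w (\<lambda>q t. phase h t (F q t))"
  by (erule bigO_dominated[where C = 1]) (auto simp: norm_phase)

lemma bigO_phase_at: "bigO w F \<Longrightarrow> bigO w (\<lambda>q t. phase h t0 (F q t))"
  by (erule bigO_dominated[where C = 1]) (auto simp: norm_phase)

lemma has_deriv_phase:
  assumes "has_deriv F F'"
  shows "has_deriv (\<lambda>q t. phase h t (F q t))
    (\<lambda>q t. phase h t (\<lambda>j k. F' q t j k + \<i> * of_int (j^2 - k^2) / of_real h * F q t j k))"
  unfolding has_deriv_def phase_def
proof (intro ballI allI)
  fix q t j k assume "q \<in> \<Omega>" "t \<in> I"
  then have "((\<lambda>s. osc h s (j^2 - k^2) * F q s j k) has_vector_derivative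
      osc h t (j^2 - k^2) * F' q t j k + \<i> * of_int (j^2 - k^2) / of_real h * osc h t (j^2 - k^2) * F q t j k) (at t within I)"
    using assms unfolding has_deriv_def by (intro has_vector_derivative_mult has_vector_derivative_osc) auto
  then show "((\<lambda>s. osc h s (j^2 - k^2) * F q s j k) has_vector_derivative
      osc h t (j^2 - k^2) * (F' q t j k + \<i> * of_int (j^2 - k^2) / of_real h * F q t j k)) (at t within I)"
    by (simp add: algebra_simps)
qed

end

locale schroedinger_family = weighted_family \<alpha> \<Omega> \<beta>
  for \<alpha> and \<Omega> :: "'q set" and \<beta> +
  fixes h cv :: real and v :: "'q \<Rightarrow> int \<Rightarrow> real \<Rightarrow> complex" and W :: "'q \<Rightarrow> real \<Rightarrow> zmat"
  assumes h_pos: "h > 0" and cv_pos: "cv > 0"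
    and C_class: "q \<in> \<Omega> \<Longrightarrow> C_class \<alpha> (\<beta> q) 2 cv (v q)"
    and real_valued: "q \<in> \<Omega> \<Longrightarrow> v q (- k) t = cnj (v q k t)"
    and periodic: "q \<in> \<Omega> \<Longrightarrow> v q k (t + 2 * pi) = v q k t"
    and mean_zero: "q \<in> \<Omega> \<Longrightarrow> v q 0 t = 0"
    and fund_sol: "q \<in> \<Omega> \<Longrightarrow> fund_sol h (v q) (W q)"
begin

abbreviation ih :: complex where "ih \<equiv> \<i> * complex_of_real h"

definition V where "V q t j k = v q (j - k) t"
definition V1 where "V1 q t j k = tder (v q (j - k)) t"
definition V2 where "V2 q t j k = tder (tder (v q (j - k))) t"

lemma
  assumes "q \<in> \<Omega>"
  shows norm_V: "norm (V q t j k) \<le> cv * wW (\<beta> q) j k"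
    and norm_V1: "norm (V1 q t j k) \<le> cv * wW (\<beta> q) j k"
    and norm_V2: "norm (V2 q t j k) \<le> cv * wW (\<beta> q) j k"
    and V_deriv: "((\<lambda>s. V q s j k) has_vector_derivative V1 q t j k) (at t within S)"
    and V1_deriv: "((\<lambda>s. V1 q s j k) has_vector_derivative V2 q t j k) (at t within S)"
proof -
  note C = C_class[OF assms, unfolded C_class_def, rule_format, of "j - k"]
  have "norm (((tder ^^ i) (v q (j - k))) t) \<le> cv * wW (\<beta> q) j k" if "i \<le> 2" for i
    using C that by (simp add: wW_def kern_def)
  from this[of 0] this[of 1] this[of 2]
  show "norm (V q t j k) \<le> cv * wW (\<beta> q) j k" "norm (V1 q t j k) \<le> cv * wW (\<beta> q) j k"
    "norm (V2 q t j k) \<le> cv * wW (\<beta> q) j k"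
    by (simp_all add: V_def V1_def V2_def numeral_2_eq_2)
  have d: "((tder ^^ i) (v q (j - k))) differentiable (at t)" if "i < 2" for i
    using C that by blast
  have "(v q (j - k) has_vector_derivative tder (v q (j - k)) t) (at t)"
    "(tder (v q (j - k)) has_vector_derivative tder (tder (v q (j - k))) t) (at t)"
    using d[of 0] d[of 1] by (simp_all add: vector_derivative_works tder_def)
  then show "((\<lambda>s. V q s j k) has_vector_derivative V1 q t j k) (at t within S)"
    "((\<lambda>s. V1 q s j k) has_vector_derivative V2 q t j k) (at t within S)"
    unfolding V_def V1_def V2_def by (auto intro: has_vector_derivative_at_within)
qed

lemma bigO_V: "bigO wW V" and bigO_V1: "bigO wW V1" and bigO_V2: "bigO wW V2"
  using norm_V norm_V1 norm_V2 cv_pos by (auto intro!: bigOI[where c = cv])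

text \<open>Undoing the free flow removes the unbounded diagonal term from the equation.\<close>

definition X :: "'q \<Rightarrow> real \<Rightarrow> zmat" where
  "X q t j k = osc h t (j^2) * W q t j k"

lemma norm_X: "norm (X q t j k) = norm (W q t j k)"
  by (simp add: X_def norm_mult norm_osc)

lemma X_0: "q \<in> \<Omega> \<Longrightarrow> X q 0 = mat_one"
  using fund_sol[of q] by (auto simp: X_def osc_0 fund_sol_def mat_one_def fun_eq_iff)

lemma X_deriv:
  assumes "q \<in> \<Omega>"
  shows "((\<lambda>s. X q s j k) has_vector_derivative mat_mul (phase h t (V q t)) (X q t) j k / ih) (at t within S)"
proof -
  let ?s = "\<Sum>\<^sub>\<infinity>l. v q (j - l) t * W q t l k"
  have "((\<lambda>s. W q s j k) has_vector_derivative (of_int (j^2) * W q t j k + ?s) / ih) (at t within S)"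
    using fund_sol[OF assms] by (auto simp: fund_sol_def intro: has_vector_derivative_at_within)
  then have "((\<lambda>s. X q s j k) has_vector_derivative
      osc h t (j^2) * ((of_int (j^2) * W q t j k + ?s) / ih) + (\<i> * of_int (j^2) / of_real h) * osc h t (j^2) * W q t j k) (at t within S)"
    unfolding X_def by (intro has_vector_derivative_mult has_vector_derivative_osc)
  also have "osc h t (j^2) * ((of_int (j^2) * W q t j k + ?s) / ih) + (\<i> * of_int (j^2) / of_real h) * osc h t (j^2) * W q t j k
      = osc h t (j^2) * ?s / ih"
    using h_pos by (simp add: field_simps)
  also have "osc h t (j^2) * ?s = mat_mul (phase h t (V q t)) (X q t) j k"
  proof -
    have "phase h t (V q t) j l * X q t l k = osc h t (j^2) * (v q (j - l) t * W q t l k)" for l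
      using osc_add[of h t "j^2 - l^2" "l^2"] by (simp add: phase_def X_def V_def mult_ac)
    then show ?thesis by (simp add: mat_mul_def infsum_cmult_right')
  qed
  finally show ?thesis .
qed

text \<open>Picard iteration as a chain of differential inequalities. Unitarity alone gives the
  bound 1, without decay away from the diagonal; inserting each bound into the equation for
  \<open>X\<close> yields the next. The decaying part reproduces itself under convolution with the
  kernel, while the remainder gains one order in each round and vanishes as \<open>n\<close>
  grows.\<close>

lemma norm_X_le_iterate:
  assumes q: "q \<in> \<Omega>" and "0 \<le> t"
  shows "norm (X q t j k) \<le> exp (K * cv / h * t) * wW (\<beta> q) j k + (K * cv / h * t) ^ n / fact n"
  using assms(2)
proof (induction n arbitrary: t j)
  case 0
  have "norm (X q t j k) \<le> 1"
    unfolding norm_X using fund_sol[OF q] by (intro unitary_mat_norm_le_1) (auto simp: fund_sol_def)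
  also have "1 \<le> exp (K * cv / h * t) * wW (\<beta> q) j k + 1" by (simp add: w_nonneg)
  finally show ?case by simp
next
  case (Suc n)
  define \<mu> where "\<mu> = K * cv / h"
  define w where "w = wW (\<beta> q) j k"
  define \<phi> where "\<phi> s = exp (\<mu> * s) * w + (\<mu> * s) ^ Suc n / fact (Suc n)" for s
  have lam: "0 \<le> \<mu>" using K_pos cv_pos h_pos by (simp add: \<mu>_def)
  have b: "0 \<le> \<beta> q" using q by (rule beta_nonneg)
  have KK: "conv_const \<alpha> \<le> K" using conv_const_ge_1[of "\<alpha> - 1"] alpha by (simp add: K_def)
  have delta: "norm (X q 0 j k) \<le> w"
    unfolding X_0[OF q] w_def by (auto simp: mat_one_def wW_def kern_self kern_nonneg)
  show ?case
  proof (cases "t = 0")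
    case True
    then show ?thesis using delta by (simp add: w_def)
  next
    case False
    have "norm (X q t j k - X q 0 j k) \<le> \<phi> t - \<phi> 0"
    proof (rule differentiable_bound_general)
      show "0 < t" using False Suc.prems by simp
      show "((\<lambda>s. X q s j k) has_vector_derivative mat_mul (phase h s (V q s)) (X q s) j k / ih) (at s)" for s
        using q by (rule X_deriv)
      then show "continuous_on {0..t} (\<lambda>s. X q s j k)"
        by (meson continuous_at_imp_continuous_on has_vector_derivative_continuous)
      have "(\<phi> has_real_derivative exp (\<mu> * s) * \<mu> * w + (real (Suc n) * (\<mu> * s) ^ n * \<mu>) / fact (Suc n)) (at s)" for s
        unfolding \<phi>_def by (rule derivative_eq_intros refl | simp)+
      moreover have "exp (\<mu> * s) * \<mu> * w + (real (Suc n) * (\<mu> * s) ^ n * \<mu>) / fact (Suc n)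
          = \<mu> * (exp (\<mu> * s) * w + (\<mu> * s) ^ n / fact n)" for s
        by (simp add: divide_simps) (simp add: algebra_simps)
      ultimately show "(\<phi> has_vector_derivative \<mu> * (exp (\<mu> * s) * w + (\<mu> * s) ^ n / fact n)) (at s)" for s
        by (simp add: has_real_derivative_iff_has_vector_derivative)
      show "continuous_on {0..t} \<phi>" unfolding \<phi>_def by (intro continuous_intros) auto
      fix s assume s: "0 < s" "s < t"
      let ?e = "exp (\<mu> * s)" and ?r = "(\<mu> * s) ^ n / fact n"
      have r0: "0 \<le> cv * ?r" using lam s cv_pos by simp
      \<comment> \<open>The decaying part of the bound is convolved with the kernel; the remainder
        \<open>?r\<close> does not depend on \<open>l\<close> and needs only the row sum.
        \<open>K\<close> bounds the constants of both.\<close>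
      let ?g = "\<lambda>l. cv * ?e * (kern \<alpha> (\<beta> q) j l * kern \<alpha> (\<beta> q) l k) + cv * ?r * kern \<alpha> (\<beta> q) j l"
      have g: "?g summable_on UNIV"
        using alpha b by (intro summable_on_add summable_on_cmult_right kern_conv_summable kern_sum) auto
      have le: "norm (phase h s (V q s) j l * X q s l k) \<le> ?g l" for l
      proof -
        have "norm (phase h s (V q s) j l * X q s l k) \<le> (cv * wW (\<beta> q) j l) * (?e * wW (\<beta> q) l k + ?r)"
          unfolding norm_mult norm_phase using Suc.IH[of s l] s cv_pos
          by (intro mult_mono norm_V q) (auto simp: w_nonneg \<mu>_def)
        then show ?thesis by (simp add: algebra_simps wW_def)
      qed
      have sm: "(\<lambda>l. norm (phase h s (V q s) j l * X q s l k)) summable_on UNIV"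
        by (rule summable_on_comparison_test[OF g]) (rule le norm_ge_zero)+
      have "norm (mat_mul (phase h s (V q s)) (X q s) j k) \<le> (\<Sum>\<^sub>\<infinity>l. norm (phase h s (V q s) j l * X q s l k))"
        unfolding mat_mul_def by (rule norm_infsum_bound[OF sm])
      also have "\<dots> \<le> infsum ?g UNIV" by (intro infsum_mono sm g le)
      also have "\<dots> = cv * ?e * (\<Sum>\<^sub>\<infinity>l. kern \<alpha> (\<beta> q) j l * kern \<alpha> (\<beta> q) l k) + cv * ?r * (\<Sum>\<^sub>\<infinity>l. kern \<alpha> (\<beta> q) j l)"
        unfolding infsum_cmult_right'[symmetric] using alpha b
        by (intro infsum_add summable_on_cmult_right kern_conv_summable kern_sum) auto
      also have "\<dots> \<le> cv * ?e * (K * w) + cv * ?r * K"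
      proof (intro add_mono mult_left_mono)
        have "(\<Sum>\<^sub>\<infinity>l. kern \<alpha> (\<beta> q) j l * kern \<alpha> (\<beta> q) l k) \<le> conv_const \<alpha> * kern \<alpha> (\<beta> q) j k"
          using alpha b by (intro kern_conv_le) auto
        also have "\<dots> \<le> K * w" unfolding w_def wW_def by (intro mult_right_mono KK kern_nonneg)
        finally show "(\<Sum>\<^sub>\<infinity>l. kern \<alpha> (\<beta> q) j l * kern \<alpha> (\<beta> q) l k) \<le> K * w" .
        show "(\<Sum>\<^sub>\<infinity>l. kern \<alpha> (\<beta> q) j l) \<le> K"
          using kern_sum(2)[of \<alpha> "\<beta> q" j] alpha b KK by simp
      qed (use cv_pos r0 in auto)
      finally have "norm (mat_mul (phase h s (V q s)) (X q s) j k) / h \<le> (cv * ?e * (K * w) + cv * ?r * K) / h"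
        using h_pos by (intro divide_right_mono) auto
      also have "\<dots> = \<mu> * (?e * w + ?r)" by (simp add: \<mu>_def add_divide_distrib algebra_simps)
      finally show "norm (mat_mul (phase h s (V q s)) (X q s) j k / ih) \<le> \<mu> * (?e * w + ?r)"
        using h_pos by (simp add: norm_divide norm_mult)
    qed
    moreover have "\<phi> 0 = w" by (simp add: \<phi>_def)
    moreover have "norm (X q t j k) \<le> norm (X q 0 j k) + norm (X q t j k - X q 0 j k)"
      by (rule norm_triangle_sub)
    ultimately show ?thesis using delta unfolding \<phi>_def w_def \<mu>_def by simp
  qed
qed

lemma bigO_X: "bigO wW X"
proof (rule bigOI)
  fix q t j k assume q: "q \<in> \<Omega>" and "t \<in> I"
  then have t: "0 \<le> t" "t \<le> 2 * pi" by (auto simp: I_def)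
  let ?\<mu> = "K * cv / h"
  have "(\<lambda>n. exp (?\<mu> * t) * wW (\<beta> q) j k + (?\<mu> * t) ^ n / fact n) \<longlonglongrightarrow> exp (?\<mu> * t) * wW (\<beta> q) j k + 0"
    using summable_LIMSEQ_zero[OF summable_exp[of "?\<mu> * t"]]
    by (intro tendsto_intros) (simp add: field_simps)
  then have "norm (X q t j k) \<le> exp (?\<mu> * t) * wW (\<beta> q) j k + 0"
    using norm_X_le_iterate[OF q t(1)] by (intro LIMSEQ_le_const) auto
  also have "\<dots> \<le> exp (?\<mu> * (2 * pi)) * wW (\<beta> q) j k + 0"
    using t K_pos cv_pos h_pos
    by (intro add_mono mult_right_mono exp_le_cancel_iff[THEN iffD2] mult_left_mono divide_nonneg_pos w_nonneg) auto
  finally show "norm (X q t j k) \<le> exp (?\<mu> * (2 * pi)) * wW (\<beta> q) j k" by simp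
qed simp

lemma has_deriv_X: "has_deriv X (\<lambda>q t j k. 1 / ih * mat_mul (phase h t (V q t)) (X q t) j k)"
  unfolding has_deriv_def using X_deriv by simp

end

section \<open>Averaging\<close>

text \<open>In general the difference is \<open>2 / (4 * j^2 - m^2)\<close>, of order
  \<open>1 / j^2\<close> for fixed \<open>m\<close>, while each term alone is only of order
  \<open>1 / j\<close>. For |m| > |j| the right side is at least 8, and the left side is at most 2
  because a nonzero integer has absolute value at least 1.\<close>

lemma reflection_kernel_bound:
  "\<bar>1 / (m * (2 * j - m)) - 1 / (m * (2 * j + m))\<bar> \<le> 8 * (\<bar>m\<bar> + 1)^2 / (\<bar>j\<bar> + 1)^2"
  if mj: "m = real_of_int m'" "j = real_of_int j'" for m j :: real
proof (cases "m = 0")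
  case False
  then have m1: "1 \<le> \<bar>m\<bar>" using mj by simp
  have rhs_ge: "8 * \<bar>m\<bar>^2 / (\<bar>j\<bar> + 1)^2 \<le> 8 * (\<bar>m\<bar> + 1)^2 / (\<bar>j\<bar> + 1)^2"
    by (intro divide_right_mono mult_left_mono power_mono) auto
  show ?thesis
  proof (cases "m = 2 * j \<or> m = - 2 * j")
    \<comment> \<open>One of the two fractions is a division by zero, hence 0, and the other has
      absolute value \<open>1 / (8 * j^2)\<close>.\<close>
    case True
    then have "j' \<noteq> 0" using m1 mj by auto
    then have "1 \<le> \<bar>j'\<bar>" by linarith
    then have j1: "1 \<le> \<bar>j\<bar>" unfolding mj by linarith
    have "(\<bar>j\<bar> + 1)^2 \<le> (2 * \<bar>j\<bar>)^2" using j1 by (intro power_mono) auto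
    then have "1 / (8 * j^2) \<le> 8 * 1 / (\<bar>j\<bar> + 1)^2"
    proof -
      have "(\<bar>j\<bar> + 1)^2 \<le> 4 * j^2" using \<open>(\<bar>j\<bar> + 1)^2 \<le> (2 * \<bar>j\<bar>)^2\<close> by (simp add: power_mult_distrib)
      with zero_le_power2[of j] have "(\<bar>j\<bar> + 1)^2 \<le> 64 * j^2" by linarith
      then show ?thesis using j1 by (auto simp: divide_simps)
    qed
    also have "\<dots> \<le> 8 * \<bar>m\<bar>^2 / (\<bar>j\<bar> + 1)^2"
      using m1 by (intro divide_right_mono mult_left_mono one_le_power) auto
    finally have "1 / (8 * j^2) \<le> 8 * (\<bar>m\<bar> + 1)^2 / (\<bar>j\<bar> + 1)^2" using rhs_ge by linarith
    moreover have "\<bar>1 / (m * (2 * j - m)) - 1 / (m * (2 * j + m))\<bar> = 1 / (8 * j^2)"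
      using True by (auto simp: power2_eq_square abs_mult)
    ultimately show ?thesis by simp
  next
    case nz: False
    have "1 / (m * (2 * j - m)) - 1 / (m * (2 * j + m)) = 2 / (4 * j^2 - m^2)"
    proof -
      have "2 * j - m \<noteq> 0" "2 * j + m \<noteq> 0" using nz by auto
      moreover have "4 * j^2 - m^2 = (2 * j - m) * (2 * j + m)" by (simp add: power2_eq_square algebra_simps)
      ultimately show ?thesis using False by (simp add: divide_simps)
    qed
    moreover have "2 / \<bar>4 * j^2 - m^2\<bar> \<le> 8 * (\<bar>m\<bar> + 1)^2 / (\<bar>j\<bar> + 1)^2"
    proof (cases "\<bar>m\<bar> \<le> \<bar>j\<bar>")
      case True
      then have j1: "1 \<le> \<bar>j\<bar>" using m1 by linarith
      have "m^2 \<le> j^2" using True by (simp add: abs_le_square_iff)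
      moreover have "1 \<le> j^2" using one_le_power[OF j1, of 2] by simp
      ultimately have "2 / \<bar>4 * j^2 - m^2\<bar> \<le> 2 / (3 * j^2)"
        by (intro frac_le) auto
      also have "\<dots> \<le> 8 * 1 / (\<bar>j\<bar> + 1)^2"
      proof -
        have "(\<bar>j\<bar> + 1)^2 \<le> (2 * \<bar>j\<bar>)^2" using j1 by (intro power_mono) auto
        then have "(\<bar>j\<bar> + 1)^2 \<le> 4 * j^2" by (simp add: power_mult_distrib)
        with zero_le_power2[of j] have "(\<bar>j\<bar> + 1)^2 \<le> 12 * j^2" by linarith
        then show ?thesis using j1 by (auto simp: divide_simps)
      qed
      also have "\<dots> \<le> 8 * \<bar>m\<bar>^2 / (\<bar>j\<bar> + 1)^2"
        using m1 by (intro divide_right_mono mult_left_mono one_le_power) auto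
      finally show ?thesis using rhs_ge by linarith
    next
      case False
      have "4 * j'^2 - m'^2 \<noteq> 0"
      proof
        assume "4 * j'^2 - m'^2 = 0"
        then have "(2 * j' - m') * (2 * j' + m') = 0" by (simp add: power2_eq_square algebra_simps)
        then show False using nz mj by auto
      qed
      then have "1 \<le> \<bar>4 * j'^2 - m'^2\<bar>" by linarith
      then have "1 \<le> \<bar>real_of_int (4 * j'^2 - m'^2)\<bar>" by linarith
      then have "1 \<le> \<bar>4 * j^2 - m^2\<bar>" by (simp add: mj)
      then have "2 / \<bar>4 * j^2 - m^2\<bar> \<le> 2 / 1" by (intro divide_left_mono) auto
      also have "\<dots> \<le> 8 * ((\<bar>j\<bar> + 1)^2 / (\<bar>j\<bar> + 1)^2)"
        using abs_ge_zero[of j] by (simp add: add_nonneg_eq_0_iff)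
      also have "\<dots> \<le> 8 * ((\<bar>m\<bar> + 1)^2 / (\<bar>j\<bar> + 1)^2)"
        using False by (intro mult_left_mono divide_right_mono power_mono) auto
      finally show ?thesis by simp
    qed
    ultimately show ?thesis by simp
  qed
qed simp

text \<open>Evenness of \<open>f\<close> allows averaging over \<open>m\<close> and
  \<open>- m\<close>, which produces the difference from \<open>reflection_kernel_bound\<close>; its
  growth in \<open>m\<close> is absorbed by \<open>f\<close>. The 4 is the 8 of that lemma, halved
  because the paired sum counts everything twice.\<close>

lemma reflection_sum_bound:
  fixes f :: "int \<Rightarrow> real"
  assumes "\<And>m. f (- m) = f m" "\<And>m. 0 \<le> f m" and le: "\<And>m. f m * (jbr m)^2 \<le> g m"
    and g: "g summable_on UNIV"
    and s: "(\<lambda>m. f m / of_int (m * (2 * j - m))) summable_on UNIV"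
  shows "\<bar>\<Sum>\<^sub>\<infinity>m. f m / of_int (m * (2 * j - m))\<bar> \<le> 4 * infsum g UNIV / (jbr j)^2"
proof -
  let ?T = "\<lambda>m. f m / of_int (m * (2 * j - m))"
  have bij: "bij (uminus :: int \<Rightarrow> int)" by (rule bij_uminus)
  have s': "(\<lambda>m. ?T (- m)) summable_on UNIV"
    using summable_on_reindex_bij_betw[OF bij, of ?T] s by simp
  have "(\<Sum>\<^sub>\<infinity>m. ?T (- m)) = infsum ?T UNIV"
    using infsum_reindex_bij_betw[OF bij, of ?T] by simp
  then have "2 * infsum ?T UNIV = (\<Sum>\<^sub>\<infinity>m. ?T m + ?T (- m))"
    unfolding infsum_add[OF s s'] by simp
  moreover have pw: "norm (?T m + ?T (- m)) \<le> 8 / (jbr j)^2 * g m" for m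
  proof -
    have "?T (- m) = - (f m * (1 / (real_of_int m * (2 * real_of_int j + real_of_int m))))"
      by (simp add: assms(1))
    moreover have "?T m = f m * (1 / (real_of_int m * (2 * real_of_int j - real_of_int m)))" by simp
    ultimately have "?T m + ?T (- m) = f m * (1 / (real_of_int m * (2 * real_of_int j - real_of_int m))
        - 1 / (real_of_int m * (2 * real_of_int j + real_of_int m)))"
      by (simp only: right_diff_distrib add_uminus_conv_diff)
    then have "norm (?T m + ?T (- m)) = f m * \<bar>1 / (real_of_int m * (2 * real_of_int j - real_of_int m))
        - 1 / (real_of_int m * (2 * real_of_int j + real_of_int m))\<bar>"
      using assms(2)[of m] by (simp add: abs_mult)
    also have "\<dots> \<le> f m * (8 * (jbr m)^2 / (jbr j)^2)"
      using reflection_kernel_bound[OF refl refl, of m j] assms(2)[of m]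
      by (intro mult_left_mono) (auto simp: jbr_def)
    also have "\<dots> = 8 / (jbr j)^2 * (f m * (jbr m)^2)" by simp
    also have "\<dots> \<le> 8 / (jbr j)^2 * g m" by (intro mult_left_mono le) auto
    finally show ?thesis .
  qed
  moreover have "norm (\<Sum>\<^sub>\<infinity>m. ?T m + ?T (- m)) \<le> (\<Sum>\<^sub>\<infinity>m. 8 / (jbr j)^2 * g m)"
    using pw by (intro norm_infsum_le[OF has_sum_infsum has_sum_infsum] summable_on_add s s' summable_on_cmult_right g) auto
  ultimately have "norm (2 * infsum ?T UNIV) \<le> 8 / (jbr j)^2 * infsum g UNIV"
    by (simp only: infsum_cmult_right')
  then show ?thesis by simp
qed

context weighted_family
begin

lemma has_deriv_diff:
  "has_deriv F F' \<Longrightarrow> has_deriv G G' \<Longrightarrow> has_deriv (\<lambda>q t j k. F q t j k - G q t j k) (\<lambda>q t j k. F' q t j k - G' q t j k)"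
  unfolding has_deriv_def by (auto intro: has_vector_derivative_diff)

lemma has_deriv_scale:
  "has_deriv F F' \<Longrightarrow> has_deriv (\<lambda>q t j k. x * F q t j k) (\<lambda>q t j k. x * F' q t j k)"
  unfolding has_deriv_def by (auto intro: has_vector_derivative_mult_right)

lemma has_deriv_sqdiv:
  "has_deriv F F' \<Longrightarrow> has_deriv (\<lambda>q t. sqdiv (F q t)) (\<lambda>q t. sqdiv (F' q t))"
  unfolding has_deriv_def sqdiv_def by (auto intro: has_vector_derivative_divide)

lemma has_deriv_one: "has_deriv (\<lambda>q t. mat_one) (\<lambda>q t j k. 0)"
  unfolding has_deriv_def by auto

end

context schroedinger_family
begin

text \<open>\<open>C\<close> is built so that \<open>(phase(C) X)'\<close> lies in \<open>T\<close>: the primitive \<open>a\<close> removes the antidiagonal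
  part of \<open>V\<close>, \<open>sqdiv V\<close> its nonresonant part, and \<open>G\<close> the nonresonant part \<open>S\<close> of what these two leave over.
  Names ending in \<open>1\<close> are time derivatives. As \<open>x / 0 = 0\<close>, \<open>sqdiv\<close> annihilates the resonant entries.\<close>

definition A where "A q t j k = (if k = - j then V q t j k else 0)"
definition P where "P q t j k = (if j^2 = k^2 then 0 else V q t j k)"
definition P1 where "P1 q t j k = (if j^2 = k^2 then 0 else V1 q t j k)"
definition a where "a q t j k = (if k = - j then integral {0..t} (v q (j - k)) / ih else 0)"
definition D where "D q t j k = a q t j k - sqdiv (V q t) j k"
definition D1 where "D1 q t j k = A q t j k / ih - sqdiv (V1 q t) j k"
definition N where "N q t = mat_mul (D q t) (P q t)"
definition N1 where "N1 q t j k = mat_mul (D1 q t) (P q t) j k + mat_mul (D q t) (P1 q t) j k"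
definition S where "S q t j k = sqdiv (V1 q t) j k - 1 / ih * N q t j k"
definition S1 where "S1 q t j k = sqdiv (V2 q t) j k - 1 / ih * N1 q t j k"
definition G where "G q t j k = of_real h / \<i> * sqdiv (S q t) j k"
definition G1 where "G1 q t j k = of_real h / \<i> * sqdiv (S1 q t) j k"
definition C where "C q t j k = mat_one j k - D q t j k - G q t j k"
definition C1 where "C1 q t j k = 0 - D1 q t j k - G1 q t j k"

lemma bigO_A: "bigO wJ A"
  unfolding A_def using bigO_antidiag[OF bigO_V] .

lemma bigO_P: "bigO wW P"
  using bigO_V by (rule bigO_dominated[where C = 1]) (auto simp: P_def)

lemma bigO_P1: "bigO wW P1"
  using bigO_V1 by (rule bigO_dominated[where C = 1]) (auto simp: P1_def)

lemma continuous_v: "q \<in> \<Omega> \<Longrightarrow> continuous_on T (v q k)"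
  using V_deriv[of q k 0] unfolding V_def
  by (intro continuous_at_imp_continuous_on) (auto intro: has_vector_derivative_continuous)

lemma bigO_a: "bigO wJ a"
proof -
  have "bigO wW (\<lambda>q t j k. integral {0..t} (v q (j - k)) / ih)"
  proof (rule bigOI)
    fix q t j k assume q: "q \<in> \<Omega>" and "t \<in> I"
    then have t: "0 \<le> t" "t \<le> 2 * pi" by (auto simp: I_def)
    have "norm (integral {0..t} (v q (j - k))) \<le> cv * wW (\<beta> q) j k * (t - 0)"
      using norm_V[OF q, of _ j k] t by (intro integral_bound continuous_v q) (auto simp: V_def)
    also have "\<dots> \<le> cv * wW (\<beta> q) j k * (2 * pi)"
      using t cv_pos by (intro mult_left_mono) (auto simp: w_nonneg)
    finally have "norm (integral {0..t} (v q (j - k))) / h \<le> cv * wW (\<beta> q) j k * (2 * pi) / h"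
      using h_pos by (intro divide_right_mono) auto
    then show "norm (integral {0..t} (v q (j - k)) / ih) \<le> (cv * (2 * pi) / h) * wW (\<beta> q) j k"
      using h_pos by (simp add: norm_divide norm_mult mult_ac)
  qed (use cv_pos h_pos in auto)
  from bigO_antidiag[OF this] show ?thesis unfolding a_def .
qed

lemma has_deriv_a: "has_deriv a (\<lambda>q t j k. A q t j k / ih)"
  unfolding has_deriv_def
proof (intro ballI allI)
  fix q t j k assume q: "q \<in> \<Omega>" and "t \<in> I"
  then have "((\<lambda>s. integral {0..s} (v q (j - k)) / ih) has_vector_derivative v q (j - k) t / ih) (at t within I)"
    unfolding I_def
    by (intro has_vector_derivative_divide integral_has_vector_derivative continuous_v) auto
  then show "((\<lambda>s. a q s j k) has_vector_derivative A q t j k / ih) (at t within I)"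
    by (cases "k = - j") (simp_all add: a_def A_def V_def)
qed

lemma has_deriv_V: "has_deriv V V1" and has_deriv_V1: "has_deriv V1 V2" and has_deriv_P: "has_deriv P P1"
  unfolding has_deriv_def P_def P1_def using V_deriv V1_deriv by auto

lemma bigO_D: "bigO wJ D"
  unfolding D_def by (intro bigO_diff bigO_a bigO_sqdiv_W bigO_V)

lemma bigO_D1: "bigO wJ D1"
  unfolding D1_def using bigO_diff[OF bigO_scale[OF bigO_A, of "1 / ih"] bigO_sqdiv_W[OF bigO_V1]] by simp

lemma has_deriv_D: "has_deriv D D1"
  unfolding D_def D1_def by (intro has_deriv_diff has_deriv_a has_deriv_sqdiv has_deriv_V)

lemma bigO_N: "bigO wJ N" and bigO_N1: "bigO wJ N1"
  unfolding N_def N1_def by (intro bigO_add bigO_JW bigO_D bigO_D1 bigO_P bigO_P1)+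

lemma has_deriv_N: "has_deriv N N1"
  unfolding N_def N1_def
  by (rule has_deriv_mat_mul[OF bigO_J_imp_W[OF bigO_D] bigO_J_imp_W[OF bigO_D1] bigO_P bigO_P1 has_deriv_D has_deriv_P])

lemma bigO_S: "bigO wJ S" and bigO_S1: "bigO wJ S1"
  unfolding S_def S1_def by (intro bigO_diff bigO_scale bigO_sqdiv_W bigO_V1 bigO_V2 bigO_N bigO_N1)+

lemma bigO_G: "bigO wT G" and bigO_G1: "bigO wT G1"
  unfolding G_def G1_def by (intro bigO_scale bigO_sqdiv_J bigO_S bigO_S1)+

lemma bigO_C: "bigO wW C"
  unfolding C_def by (intro bigO_diff bigO_one bigO_J_imp_W[OF bigO_D] bigO_T_imp_W[OF bigO_G])

lemma has_deriv_C: "has_deriv C C1"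
  unfolding C_def C1_def G_def G1_def S_def S1_def
  by (intro has_deriv_diff has_deriv_one has_deriv_D has_deriv_scale has_deriv_sqdiv has_deriv_V1 has_deriv_N)

text \<open>The antidiagonal part of \<open>D\<close> could contribute only at
  \<open>l = - j\<close>, where \<open>P\<close> vanishes because \<open>l^2 = k^2\<close>. At
  resonant \<open>l\<close> the right side is a division by zero, hence 0 as well.\<close>

lemma N_resonant:
  assumes "j^2 = k^2"
  shows "D q t j l * P q t l k = - (V q t j l * V q t l k / of_int (j^2 - l^2))"
proof (cases "l^2 = k^2")
  case True
  then show ?thesis using assms by (simp add: P_def)
next
  case False
  then have "l \<noteq> - j" using assms by auto
  then show ?thesis using False by (simp add: D_def P_def a_def sqdiv_def)
qed

text \<open>With \<open>l = j - m\<close>, reality turns the product of the two potential entries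
  into the squared modulus of \<open>v q m t\<close>, which is even in \<open>m\<close>, over the
  denominator \<open>m * (2 * j - m)\<close>. Pairing \<open>m\<close> with \<open>- m\<close> then
  yields the weight of \<open>T\<close> on the diagonal.\<close>

lemma norm_N_diag:
  assumes q: "q \<in> \<Omega>" and t: "t \<in> I"
  shows "norm (N q t j j) \<le> 4 * cv^2 * (\<Sum>\<^sub>\<infinity>l. 1 / jbr l powr \<alpha>) / (jbr j)^2"
proof -
  define f where "f m = (norm (v q m t))^2" for m
  have vle: "norm (v q m t) \<le> cv / jbr m powr \<alpha>" for m
  proof -
    have "norm (v q m t) \<le> cv * wW (\<beta> q) m 0" using norm_V[OF q, of t m 0] by (simp add: V_def)
    also have "\<dots> \<le> cv * (1 / jbr m powr \<alpha>)"
    proof -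
      have "exp (- \<beta> q * \<bar>m\<bar>) \<le> 1" using beta_nonneg[OF q] by simp
      then show ?thesis
        unfolding wW_def kern_def diff_zero using cv_pos by (intro mult_left_mono divide_right_mono) auto
    qed
    finally show ?thesis by simp
  qed
  \<comment> \<open>Since \<alpha> exceeds 2, one of the two factors
    \<open>jbr m powr \<alpha>\<close> absorbs \<open>(jbr m)^2\<close>, and the other makes the
    majorant summable.\<close>
  have f_le: "f m * (jbr m)^2 \<le> cv^2 * (1 / jbr m powr \<alpha>)" for m
  proof -
    have jp: "(jbr m)^2 \<le> jbr m powr \<alpha>"
      using alpha jbr_ge_1[of m] jbr_pos[of m] by (simp flip: powr_numeral) (intro powr_mono, auto)
    have "f m \<le> (cv / jbr m powr \<alpha>)^2" unfolding f_def using vle by (intro power_mono) auto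
    then have "f m * (jbr m)^2 \<le> (cv / jbr m powr \<alpha>)^2 * jbr m powr \<alpha>"
      using jp by (intro mult_mono) auto
    also have "\<dots> = cv^2 * (1 / jbr m powr \<alpha>)"
      using jbr_pos[of m] by (simp add: power2_eq_square)
    finally show ?thesis .
  qed
  have f_sym: "f (- m) = f m" for m by (simp add: f_def real_valued[OF q])
  let ?T = "\<lambda>m. f m / of_int (m * (2 * j - m))"
  have bij: "bij (\<lambda>m. j - m)" by (auto intro!: bijI' intro: exI[of _ "j - _"])
  have summand: "D q t j (j - m) * P q t (j - m) j = - complex_of_real (?T m)" for m
  proof -
    have "V q t j (j - m) * V q t (j - m) j = of_real (f m)"
      using real_valued[OF q, of m t] unfolding V_def f_def complex_norm_square by simp
    moreover have "j^2 - (j - m)^2 = m * (2 * j - m)" by (simp add: power2_eq_square algebra_simps)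
    ultimately show ?thesis unfolding N_resonant[OF refl] by simp
  qed
  have "(\<lambda>l. norm (D q t j l * P q t l j)) summable_on UNIV"
    using q t by (intro bigO_summable bigO_J_imp_W[OF bigO_D] bigO_P)
  then have "(\<lambda>m. norm (D q t j (j - m) * P q t (j - m) j)) summable_on UNIV"
    using summable_on_reindex_bij_betw[OF bij, of "\<lambda>l. norm (D q t j l * P q t l j)"] by simp
  then have "(\<lambda>m. norm (?T m)) summable_on UNIV" unfolding summand norm_minus_cancel norm_of_real real_norm_def .
  then have s: "?T summable_on UNIV" by (rule abs_summable_summable)
  have "N q t j j = (\<Sum>\<^sub>\<infinity>m. D q t j (j - m) * P q t (j - m) j)"
    unfolding N_def mat_mul_def
    using infsum_reindex_bij_betw[OF bij, of "\<lambda>l. D q t j l * P q t l j"] by simp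
  also have "\<dots> = - complex_of_real (infsum ?T UNIV)"
    unfolding summand infsum_uminus infsumI[OF has_sum_of_real[OF has_sum_infsum[OF s]]] ..
  finally have "norm (N q t j j) = \<bar>infsum ?T UNIV\<bar>" by simp
  also have "\<dots> \<le> 4 * (\<Sum>\<^sub>\<infinity>m. cv^2 * (1 / jbr m powr \<alpha>)) / (jbr j)^2"
  proof (rule reflection_sum_bound[OF f_sym _ f_le _ s])
    show "0 \<le> f m" for m by (simp add: f_def)
    show "(\<lambda>m. cv^2 * (1 / jbr m powr \<alpha>)) summable_on UNIV"
      using alpha by (intro summable_on_cmult_right summable_on_jbr_powr) auto
  qed
  finally show ?thesis by (simp only: infsum_cmult_right' mult.assoc)
qed

lemma kern_divide_le:
  assumes "j \<noteq> k"
  shows "kern \<alpha> b j k / \<bar>real_of_int (j - k)\<bar> \<le> 2 * kern (\<alpha> + 1) b j k"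
proof -
  have "jbr (j - k) \<le> 2 * \<bar>real_of_int (j - k)\<bar>" using assms by (simp add: jbr_def)
  then have "kern (\<alpha> + 1) b j k * jbr (j - k) \<le> kern (\<alpha> + 1) b j k * (2 * \<bar>real_of_int (j - k)\<bar>)"
    by (intro mult_left_mono kern_nonneg)
  then show ?thesis
    using kern_diff_1[of "\<alpha> + 1" b j k] assms by (simp add: pos_divide_le_eq mult_ac)
qed

text \<open>For \<open>k = - j\<close> the denominator splits as \<open>(j - l) * (l - k)\<close>.
  Dividing each potential entry by its own difference raises the kernel exponent to
  \<open>\<alpha> + 1\<close>. After convolution the kernel is taken at distance
  \<open>2 * j\<close>, where its two powers beyond \<open>\<alpha> - 1\<close> dominate
  \<open>jbr j * jbr k\<close>.\<close>

lemma norm_N_antidiag: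
  assumes q: "q \<in> \<Omega>" and t: "t \<in> I"
  shows "norm (N q t j (- j)) \<le> 4 * cv^2 * conv_const (\<alpha> + 1) * wT (\<beta> q) j (- j)"
proof -
  let ?b = "\<beta> q"
  let ?g = "\<lambda>l. 4 * cv^2 * (kern (\<alpha> + 1) ?b j l * kern (\<alpha> + 1) ?b l (- j))"
  have b: "0 \<le> ?b" using q by (rule beta_nonneg)
  have le: "norm (D q t j l * P q t l (- j)) \<le> ?g l" for l
  proof (cases "j^2 = l^2")
    case True
    then show ?thesis by (simp add: P_def kern_nonneg)
  next
    case False
    then have ne: "j \<noteq> l" "l \<noteq> - j" by auto
    have "norm (D q t j l * P q t l (- j)) = norm (V q t j l) * norm (V q t l (- j)) / norm (complex_of_int (j^2 - l^2))"
      unfolding N_resonant[OF power2_minus[symmetric]] norm_minus_cancel norm_divide norm_mult ..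
    also have "norm (complex_of_int (j^2 - l^2)) = \<bar>real_of_int (j - l)\<bar> * \<bar>real_of_int (l - - j)\<bar>"
    proof -
      have "j^2 - l^2 = (j - l) * (l - - j)" by (simp add: power2_eq_square algebra_simps)
      then show ?thesis by (simp only: of_int_mult norm_mult norm_of_int)
    qed
    also have "norm (V q t j l) * norm (V q t l (- j)) / (\<bar>real_of_int (j - l)\<bar> * \<bar>real_of_int (l - - j)\<bar>)
        = (norm (V q t j l) / \<bar>real_of_int (j - l)\<bar>) * (norm (V q t l (- j)) / \<bar>real_of_int (l - - j)\<bar>)"
      by (rule times_divide_times_eq[symmetric])
    also have "\<dots> \<le> (cv * (2 * kern (\<alpha> + 1) ?b j l)) * (cv * (2 * kern (\<alpha> + 1) ?b l (- j)))"
    proof (intro mult_mono)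
      have *: "norm (V q t i k) / \<bar>real_of_int (i - k)\<bar> \<le> cv * (2 * kern (\<alpha> + 1) ?b i k)" if "i \<noteq> k" for i k
      proof -
        have "norm (V q t i k) / \<bar>real_of_int (i - k)\<bar> \<le> (cv * kern \<alpha> ?b i k) / \<bar>real_of_int (i - k)\<bar>"
          using norm_V[OF q] by (intro divide_right_mono) (auto simp: wW_def)
        also have "\<dots> \<le> cv * (2 * kern (\<alpha> + 1) ?b i k)"
          using mult_left_mono[OF kern_divide_le[OF that], of cv] cv_pos by simp
        finally show ?thesis .
      qed
      show "norm (V q t j l) / \<bar>real_of_int (j - l)\<bar> \<le> cv * (2 * kern (\<alpha> + 1) ?b j l)"
        "norm (V q t l (- j)) / \<bar>real_of_int (l - - j)\<bar> \<le> cv * (2 * kern (\<alpha> + 1) ?b l (- j))"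
        using * ne by blast+
    qed (use cv_pos in \<open>auto simp: kern_nonneg\<close>)
    also have "\<dots> = ?g l" by (simp add: power2_eq_square)
    finally show ?thesis .
  qed
  have g: "?g summable_on UNIV" using alpha b by (intro summable_on_cmult_right kern_conv_summable) auto
  have sm: "(\<lambda>l. norm (D q t j l * P q t l (- j))) summable_on UNIV"
    by (rule summable_on_comparison_test[OF g]) (rule le norm_ge_zero)+
  have "norm (N q t j (- j)) \<le> (\<Sum>\<^sub>\<infinity>l. norm (D q t j l * P q t l (- j)))"
    unfolding N_def mat_mul_def by (rule norm_infsum_bound[OF sm])
  also have "\<dots> \<le> infsum ?g UNIV" by (intro infsum_mono sm g le)
  also have "\<dots> \<le> 4 * cv^2 * (conv_const (\<alpha> + 1) * kern (\<alpha> + 1) ?b j (- j))"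
    unfolding infsum_cmult_right' using alpha b by (intro mult_left_mono kern_conv_le) auto
  also have "\<dots> \<le> 4 * cv^2 * (conv_const (\<alpha> + 1) * wT ?b j (- j))"
  proof (intro mult_left_mono)
    have "jbr j * jbr (- j) \<le> jbr (j - - j) * jbr (j - - j)"
      by (intro mult_mono) (auto simp: jbr_def)
    then have "kern (\<alpha> + 1) ?b j (- j) * (jbr j * jbr (- j)) \<le> kern (\<alpha> + 1) ?b j (- j) * (jbr (j - - j) * jbr (j - - j))"
      by (intro mult_left_mono kern_nonneg)
    also have "\<dots> = kern (\<alpha> - 1) ?b j (- j)"
      using kern_diff_1[of "\<alpha> + 1" ?b j "- j"] kern_diff_1[of \<alpha> ?b j "- j"] by simp
    finally show "kern (\<alpha> + 1) ?b j (- j) \<le> wT ?b j (- j)"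
      unfolding wT_def using jbr_pos by (simp add: pos_le_divide_eq)
  qed (use conv_const_ge_1[of "\<alpha> + 1"] alpha in auto)
  finally show ?thesis by simp
qed

lemma bigO_N_resonant: "bigO wT (\<lambda>q t j k. if j^2 = k^2 then N q t j k else 0)"
proof -
  define c1 where "c1 = 4 * cv^2 * (\<Sum>\<^sub>\<infinity>l. 1 / jbr l powr \<alpha>)"
  define c2 where "c2 = 4 * cv^2 * conv_const (\<alpha> + 1)"
  have c1: "0 \<le> c1" unfolding c1_def by (intro mult_nonneg_nonneg infsum_nonneg) auto
  have c2: "0 \<le> c2" unfolding c2_def using conv_const_ge_1[of "\<alpha> + 1"] alpha by auto
  show ?thesis
  proof (rule bigOI)
    fix q t j k assume q: "q \<in> \<Omega>" and t: "t \<in> I"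
    have 1: "norm (N q t j j) \<le> c1 * wT (\<beta> q) j j"
      using norm_N_diag[OF q t, of j] by (simp add: c1_def wT_def kern_self power2_eq_square)
    have 2: "norm (N q t j (- j)) \<le> c2 * wT (\<beta> q) j (- j)"
      using norm_N_antidiag[OF q t, of j] by (simp add: c2_def)
    have "norm (if j^2 = k^2 then N q t j k else 0) \<le> (c1 * wT (\<beta> q) j k) + (c2 * wT (\<beta> q) j k)"
      using 1 2 c1 c2 by (auto simp: power2_eq_iff w_nonneg intro: add_increasing add_increasing2)
    then show "norm (if j^2 = k^2 then N q t j k else 0) \<le> (c1 + c2) * wT (\<beta> q) j k"
      by (simp add: distrib_right)
  qed (use c1 c2 in auto)
qed

end

context weights
begin

lemma mat_mul_diff_left:
  assumes "inW b A" "inW b B" "inW b C"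
  shows "mat_mul (\<lambda>j k. A j k - B j k) C j k = mat_mul A C j k - mat_mul B C j k"
  using mat_mul_add_left[OF assms(1) inW_scale[OF assms(2), of "-1"] assms(3)]
  by (simp add: mat_mul_uminus_left)

lemma mat_mul_diff_right:
  assumes "inW b A" "inW b B" "inW b C"
  shows "mat_mul C (\<lambda>j k. A j k - B j k) j k = mat_mul C A j k - mat_mul C B j k"
  using mat_mul_add_right[OF assms(1) inW_scale[OF assms(2), of "-1"] assms(3)]
  by (simp add: mat_mul_uminus_right)

end

context weighted_family
begin

lemma mat_mul_phase_W:
  "mat_mul (phase h t (F q t)) (mat_mul (phase h t (G q t)) (H q t)) = mat_mul (phase h t (mat_mul (F q t) (G q t))) (H q t)"
  if "bigO wW F" "bigO wW G" "bigO wW H" "q \<in> \<Omega>" "t \<in> I"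
  unfolding mat_mul_phase[symmetric]
  by (rule mat_mul_assoc[symmetric, of "\<beta> q"]) (intro bigO_inW bigO_inW[OF bigO_phase] that)+

end

section \<open>The equation satisfied by the corrected propagator\<close>

context schroedinger_family
begin

text \<open>The generator for which \<open>phase(C) X\<close> has derivative
  \<open>phase(R) X\<close>: the three terms come from differentiating \<open>C\<close>, the
  oscillating factors in \<open>phase\<close>, and \<open>X\<close>.\<close>

definition R where
  "R q t j k = C1 q t j k + \<i> * of_int (j^2 - k^2) / of_real h * C q t j k + 1 / ih * mat_mul (C q t) (V q t) j k"

text \<open>Resonance means \<open>k = j\<close> or \<open>k = - j\<close>, and the diagonal entries
  vanish because \<open>v q 0\<close> does.\<close>

lemma V_split: "q \<in> \<Omega> \<Longrightarrow> V q t = (\<lambda>j k. A q t j k + P q t j k)"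
  using mean_zero[of q t] by (auto simp: fun_eq_iff A_def P_def V_def power2_eq_iff)

text \<open>Only the product of \<open>D\<close> with the nonresonant part \<open>P\<close> is
  singled out as \<open>N\<close>: the product of \<open>D\<close> with \<open>A\<close> is
  \<open>J\<close> times \<open>J\<close>, hence already in \<open>T\<close>.\<close>

lemma mat_mul_C_V:
  assumes "q \<in> \<Omega>" "t \<in> I"
  shows "mat_mul (C q t) (V q t) j k
    = V q t j k - (mat_mul (D q t) (A q t) j k + N q t j k) - mat_mul (G q t) (V q t) j k"
proof -
  note inW = bigO_inW[OF _ assms]
  have D: "inW (\<beta> q) (D q t)" and G: "inW (\<beta> q) (G q t)" and V: "inW (\<beta> q) (V q t)"
    and A: "inW (\<beta> q) (A q t)" and P: "inW (\<beta> q) (P q t)" and one: "inW (\<beta> q) mat_one"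
    using inW bigO_D bigO_G bigO_V bigO_A bigO_P bigO_one bigO_J_imp_W bigO_T_imp_W by blast+
  have oD: "inW (\<beta> q) (\<lambda>j k. mat_one j k - D q t j k)"
    using inW[OF bigO_diff[OF bigO_one bigO_J_imp_W[OF bigO_D]]] .
  have "mat_mul (C q t) (V q t) j k = V q t j k - mat_mul (D q t) (V q t) j k - mat_mul (G q t) (V q t) j k"
    unfolding C_def mat_mul_diff_left[OF oD G V] mat_mul_diff_left[OF one D V] mat_mul_one_left ..
  also have "mat_mul (D q t) (V q t) j k = mat_mul (D q t) (A q t) j k + N q t j k"
    unfolding N_def by (subst V_split[OF assms(1)]) (rule mat_mul_add_right[OF A P D])
  finally show ?thesis .
qed

text \<open>On resonant entries the derivative of \<open>a\<close> cancels \<open>V\<close>, and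
  \<open>N\<close> remains. On nonresonant entries multiplication by \<open>j^2 - k^2\<close> undoes
  \<open>sqdiv\<close>, so that \<open>sqdiv V\<close> cancels \<open>V\<close>, and
  \<open>G\<close> cancels both \<open>sqdiv V1\<close> and \<open>N\<close>.\<close>

lemma R_eq:
  assumes "q \<in> \<Omega>" "t \<in> I"
  shows "R q t j k = - G1 q t j k - 1 / ih * (mat_mul (D q t) (A q t) j k + mat_mul (G q t) (V q t) j k)
    - 1 / ih * (if j^2 = k^2 then N q t j k else 0)"
proof (cases "j^2 = k^2")
  case True
  have "V q t j k = A q t j k + P q t j k" by (subst V_split[OF assms(1)]) (rule refl)
  then have "V q t j k = A q t j k" using True by (simp add: P_def)
  then show ?thesis
    unfolding R_def mat_mul_C_V[OF assms] using True h_pos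
    by (simp add: C1_def D1_def G1_def sqdiv_def field_simps)
next
  case False
  define m where "m = complex_of_int (j^2 - k^2)"
  have m: "m \<noteq> 0" using False unfolding m_def by (simp del: of_int_diff of_int_power)
  have ne: "k \<noteq> - j" "j \<noteq> k" using False by auto
  have c: "C q t j k = V q t j k / m - of_real h / \<i> * ((V1 q t j k / m - 1 / ih * N q t j k) / m)"
    using ne by (simp add: C_def D_def G_def S_def a_def mat_one_def sqdiv_def m_def)
  have c1: "C1 q t j k = V1 q t j k / m - G1 q t j k"
    using ne by (simp add: C1_def D1_def A_def sqdiv_def m_def)
  show ?thesis
    unfolding R_def mat_mul_C_V[OF assms] m_def[symmetric] c c1 using False m h_pos
    by (simp add: field_simps)
qed

lemma bigO_R: "bigO wT R"
proof (rule bigO_cong[OF _ R_eq])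
  show "bigO wT (\<lambda>q t j k. - G1 q t j k - 1 / ih * (mat_mul (D q t) (A q t) j k + mat_mul (G q t) (V q t) j k)
    - 1 / ih * (if j^2 = k^2 then N q t j k else 0))"
    by (intro bigO_diff bigO_uminus bigO_scale bigO_add bigO_G1 bigO_N_resonant
        bigO_JJ[OF bigO_D bigO_A] bigO_TW[OF bigO_G bigO_V])
qed

definition CX where "CX q t = mat_mul (phase h t (C q t)) (X q t)"

lemma has_deriv_CX: "has_deriv CX (\<lambda>q t. mat_mul (phase h t (R q t)) (X q t))"
proof -
  define Cd where "Cd q t j k = C1 q t j k + \<i> * of_int (j^2 - k^2) / of_real h * C q t j k" for q t j k
  have Cd_eq: "Cd q t = (\<lambda>j k. C1 q t j k + \<i> * of_int (j^2 - k^2) / of_real h * C q t j k)" for q t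
    by (simp add: fun_eq_iff Cd_def)
  have R_Cd: "R q t j k = Cd q t j k + 1 / ih * mat_mul (C q t) (V q t) j k" for q t j k
    by (simp add: R_def Cd_def)
  have CV: "bigO wW (\<lambda>q t j k. 1 / ih * mat_mul (C q t) (V q t) j k)"
    by (intro bigO_scale bigO_WW bigO_C bigO_V)
  \<comment> \<open>A direct estimate would meet the unbounded factor \<open>j^2 - k^2\<close>;
    instead \<open>Cd\<close> is bounded as \<open>R\<close> minus a multiple of the product of
    \<open>C\<close> and \<open>V\<close>.\<close>
  have Cd: "bigO wW Cd"
    by (rule bigO_cong[OF bigO_diff[OF bigO_T_imp_W[OF bigO_R] CV]]) (simp add: R_Cd)
  have "has_deriv CX (\<lambda>q t j k. mat_mul (phase h t (Cd q t)) (X q t) j k +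
      mat_mul (phase h t (C q t)) (\<lambda>j k. 1 / ih * mat_mul (phase h t (V q t)) (X q t) j k) j k)"
    unfolding CX_def
    by (intro has_deriv_mat_mul has_deriv_X bigO_X bigO_phase bigO_C Cd bigO_scale bigO_WW bigO_V
        has_deriv_phase[OF has_deriv_C, of h, folded Cd_eq])
  moreover have "mat_mul (phase h t (R q t)) (X q t) j k = mat_mul (phase h t (Cd q t)) (X q t) j k +
      mat_mul (phase h t (C q t)) (\<lambda>j k. 1 / ih * mat_mul (phase h t (V q t)) (X q t) j k) j k"
    if qt: "q \<in> \<Omega>" "t \<in> I" for q t j k
  proof -
    have "phase h t (R q t) = (\<lambda>j k. phase h t (Cd q t) j k + phase h t (\<lambda>j k. 1 / ih * mat_mul (C q t) (V q t) j k) j k)"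
      by (simp add: fun_eq_iff phase_def R_Cd distrib_left)
    then have "mat_mul (phase h t (R q t)) (X q t) j k = mat_mul (phase h t (Cd q t)) (X q t) j k
        + mat_mul (phase h t (\<lambda>j k. 1 / ih * mat_mul (C q t) (V q t) j k)) (X q t) j k"
      using mat_mul_add_left[OF bigO_inW[OF bigO_phase[OF Cd] qt] bigO_inW[OF bigO_phase[OF CV] qt] bigO_inW[OF bigO_X qt]]
      by simp
    also have "phase h t (\<lambda>j k. 1 / ih * mat_mul (C q t) (V q t) j k) = (\<lambda>j k. 1 / ih * phase h t (mat_mul (C q t) (V q t)) j k)"
      by (simp add: fun_eq_iff phase_def)
    finally show ?thesis
      unfolding mat_mul_scale_left mat_mul_scale_right mat_mul_phase_W[OF bigO_C bigO_V bigO_X qt] .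
  qed
  ultimately show ?thesis unfolding has_deriv_def by simp
qed

section \<open>Integration over one period\<close>

definition L where "L q = sqdiv (V q 0)"

lemma bigO_L: "bigO wJ (\<lambda>q t. L q)"
  unfolding L_def using bigO_at[OF bigO_sqdiv_W[OF bigO_V] I_facts(1)] .

lemma V_periodic: "q \<in> \<Omega> \<Longrightarrow> V q (2 * pi) = V q 0"
  using periodic[of q _ 0] by (simp add: V_def fun_eq_iff)

text \<open>Reality of the potential makes the numerators Hermitian, and the denominators change
  sign under transposition.\<close>

lemma L_skew: "q \<in> \<Omega> \<Longrightarrow> cnj (L q j k) = - L q k j"
  using real_valued[of q "j - k" 0, symmetric]
  by (simp add: L_def sqdiv_def V_def minus_divide_right del: minus_divide_right[symmetric])

definition X2 where "X2 q = X q (2 * pi)"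
definition a2 where "a2 q = a q (2 * pi)"
definition L2 where "L2 q = phase h (2 * pi) (L q)"

lemma bigO_X2: "bigO wW (\<lambda>q t. X2 q)" and bigO_a2: "bigO wJ (\<lambda>q t. a2 q)" and bigO_L2: "bigO wJ (\<lambda>q t. L2 q)"
  unfolding X2_def a2_def L2_def
  by (intro bigO_at[OF bigO_X] bigO_at[OF bigO_a] bigO_phase_at[OF bigO_L] I_facts)+

text \<open>The increment of \<open>CX\<close> over a period lies in \<open>T\<close>. At both ends
  \<open>G\<close> is in \<open>T\<close>, and by periodicity the \<open>sqdiv\<close> part of
  \<open>D\<close> is \<open>L\<close>; the phase at time \<open>2 * pi\<close> makes it
  \<open>L2\<close> at the final end only. The primitive \<open>a\<close> vanishes at time
  0.\<close>

lemma bigO_propagator_first_order: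
  "bigO wT (\<lambda>q t j k. X2 q j k - mat_mul (a2 q) (X2 q) j k + mat_mul (L2 q) (X2 q) j k - mat_one j k - L q j k)"
proof -
  let ?G2 = "\<lambda>q t. phase h (2 * pi) (G q (2 * pi))"
  have incr: "bigO wT (\<lambda>q t j k. CX q (2 * pi) j k - CX q 0 j k)"
    by (rule bigO_at[OF bigO_increment[OF _ has_deriv_CX w_nonneg(3)] I_facts(2)])
       (intro bigO_TW bigO_phase bigO_R bigO_X)
  have G2: "bigO wT ?G2" by (intro bigO_phase_at bigO_at[OF bigO_G] I_facts)
  have G0: "bigO wT (\<lambda>q t. G q 0)" by (intro bigO_at[OF bigO_G] I_facts)
  have "bigO wT (\<lambda>q t j k. (CX q (2 * pi) j k - CX q 0 j k) + mat_mul (?G2 q t) (X2 q) j k - G q 0 j k)"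
    by (intro bigO_diff bigO_add incr bigO_TW[OF G2 bigO_X2] G0)
  then show ?thesis
  proof (rule bigO_cong)
    fix q t j k assume q: "q \<in> \<Omega>" and t: "t \<in> I"
    note inW = bigO_inW[OF _ q t]
    have a: "inW (\<beta> q) (a2 q)" and X: "inW (\<beta> q) (X2 q)" and L: "inW (\<beta> q) (L2 q)"
      and G: "inW (\<beta> q) (?G2 q t)" and one: "inW (\<beta> q) mat_one"
      using inW bigO_a2 bigO_X2 bigO_L2 G2 bigO_one bigO_J_imp_W bigO_T_imp_W by blast+
    have aL: "inW (\<beta> q) (\<lambda>j k. a2 q j k - L2 q j k)"
      using inW[OF bigO_J_imp_W[OF bigO_diff[OF bigO_a2 bigO_L2]]] .
    have oaL: "inW (\<beta> q) (\<lambda>j k. mat_one j k - (a2 q j k - L2 q j k))"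
      using inW[OF bigO_diff[OF bigO_one bigO_J_imp_W[OF bigO_diff[OF bigO_a2 bigO_L2]]]] .
    have D: "D q (2 * pi) j k = a2 q j k - L q j k" for j k
      by (simp add: D_def a2_def L_def V_periodic[OF q])
    \<comment> \<open>Resonant entries carry zero frequency, so the phase leaves them
      unchanged.\<close>
    have "osc h (2 * pi) (j^2 - k^2) * a2 q j k = a2 q j k"
      "osc h (2 * pi) (j^2 - k^2) * mat_one j k = mat_one j k" for j k
      by (auto simp: a2_def a_def mat_one_def osc_0)
    then have "phase h (2 * pi) (C q (2 * pi)) = (\<lambda>j k. mat_one j k - (a2 q j k - L2 q j k) - ?G2 q t j k)"
      by (intro ext) (simp only: phase_def C_def D L2_def right_diff_distrib)
    then have 1: "CX q (2 * pi) j k = X2 q j k - (mat_mul (a2 q) (X2 q) j k - mat_mul (L2 q) (X2 q) j k) - mat_mul (?G2 q t) (X2 q) j k"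
      unfolding CX_def X2_def[symmetric]
      by (simp only: mat_mul_diff_left[OF oaL G X] mat_mul_diff_left[OF one aL X] mat_mul_diff_left[OF a L X] mat_mul_one_left)
    have 2: "CX q 0 j k = mat_one j k + L q j k - G q 0 j k"
      unfolding CX_def X_0[OF q] mat_mul_one_right
      by (simp add: phase_def osc_0 C_def D_def a_def L_def)
    show "X2 q j k - mat_mul (a2 q) (X2 q) j k + mat_mul (L2 q) (X2 q) j k - mat_one j k - L q j k
      = (CX q (2 * pi) j k - CX q 0 j k) + mat_mul (?G2 q t) (X2 q) j k - G q 0 j k"
      unfolding 1 2 by simp
  qed
qed

text \<open>\<open>X2\<close> differs from the identity by an element of \<open>J\<close>. Since
  \<open>J\<close> times \<open>J\<close> lies in \<open>T\<close>, the product of \<open>a2\<close>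
  and \<open>X2\<close> may be replaced by \<open>a2\<close>, and \<open>L\<close> by the product of
  \<open>X2\<close> and \<open>L\<close>.\<close>

lemma bigO_commutator:
  "bigO wT (\<lambda>q t j k. X2 q j k - mat_mul (X2 q) (L q) j k + mat_mul (L2 q) (X2 q) j k - mat_one j k - a2 q j k)"
proof -
  let ?\<tau> = "\<lambda>q j k. X2 q j k - mat_mul (a2 q) (X2 q) j k + mat_mul (L2 q) (X2 q) j k - mat_one j k - L q j k"
  let ?X = "\<lambda>q j k. X2 q j k - mat_one j k"
  have "bigO wJ (\<lambda>q t j k. ?\<tau> q j k + mat_mul (a2 q) (X2 q) j k - mat_mul (L2 q) (X2 q) j k + L q j k)"
    by (intro bigO_add bigO_diff bigO_T_imp_J[OF bigO_propagator_first_order] bigO_JW bigO_a2 bigO_L2 bigO_X2 bigO_L)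
  then have X: "bigO wJ (\<lambda>q t. ?X q)" by (rule bigO_cong) simp
  have "bigO wT (\<lambda>q t j k. ?\<tau> q j k + mat_mul (a2 q) (?X q) j k - mat_mul (?X q) (L q) j k)"
    by (intro bigO_add bigO_diff[where F = "\<lambda>q t j k. _ q t j k + _ q t j k"] bigO_propagator_first_order bigO_JJ[OF bigO_a2 X] bigO_JJ[OF X bigO_L])
  then show ?thesis
  proof (rule bigO_cong)
    fix q t j k assume qt: "q \<in> \<Omega>" "t \<in> I"
    note inW = bigO_inW[OF _ qt]
    have a: "inW (\<beta> q) (a2 q)" and X: "inW (\<beta> q) (X2 q)" and L: "inW (\<beta> q) (L q)" and one: "inW (\<beta> q) mat_one"
      using inW bigO_a2 bigO_X2 bigO_L bigO_one bigO_J_imp_W by blast+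
    show "X2 q j k - mat_mul (X2 q) (L q) j k + mat_mul (L2 q) (X2 q) j k - mat_one j k - a2 q j k
      = ?\<tau> q j k + mat_mul (a2 q) (?X q) j k - mat_mul (?X q) (L q) j k"
      unfolding mat_mul_diff_left[OF X one L] mat_mul_diff_right[OF X one a] mat_mul_one_left mat_mul_one_right
      by simp
  qed
qed

section \<open>Removal of the commutator from the monodromy\<close>

definition M where "M q = W q (2 * pi)"

lemma M_X2: "M q j k = osc h (2 * pi) (- (j^2)) * X2 q j k"
  using osc_add[of h "2 * pi" "- (j^2)" "j^2"] by (simp add: M_def X2_def X_def osc_0)

lemma bigO_M: "bigO wW (\<lambda>q t. M q)"
  using bigO_X2 by (rule bigO_dominated[where C = 1]) (auto simp: M_X2 norm_mult norm_osc)

text \<open>Multiplying row \<open>j\<close> by the free flow turns \<open>X2\<close> into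
  \<open>M\<close> and undoes the conjugation in \<open>L2\<close>, so that both products contain
  the same \<open>L\<close>. The factors have modulus 1 and leave the bound unchanged.\<close>

lemma bigO_M_commutator:
  "bigO wT (\<lambda>q t j k. M q j k - mat_mul (M q) (L q) j k + mat_mul (L q) (M q) j k - M0 h j k - Md h (v q) j k)"
  using bigO_commutator
proof (rule bigO_dominated[where C = 1])
  fix q t j k
  let ?e = "osc h (2 * pi) (- (j^2))"
  have M_L: "mat_mul (M q) (L q) j k = ?e * mat_mul (X2 q) (L q) j k"
    by (simp add: mat_mul_def M_X2 mult.assoc infsum_cmult_right')
  have "L q j l * M q l k = ?e * (L2 q j l * X2 q l k)" for l
    using osc_add[of h "2 * pi" "- (j^2)" "j^2 - l^2"] by (simp add: M_X2 L2_def phase_def mult_ac)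
  then have LM: "mat_mul (L q) (M q) j k = ?e * mat_mul (L2 q) (X2 q) j k"
    by (simp add: mat_mul_def infsum_cmult_right')
  have e: "osc h (2 * pi) (- (k^2)) = exp (complex_of_real (2*pi) / (\<i> * complex_of_real h) * of_int (k^2))" for k
    unfolding osc_def using h_pos by (intro arg_cong[where f = exp]) (simp add: field_simps)
  have M0: "M0 h j k = ?e * mat_one j k" by (simp add: M0_def mat_one_def e)
  \<comment> \<open>On the antidiagonal \<open>j - k = - 2 * k\<close> and \<open>j^2 = k^2\<close>,
    as in the definition of \<open>Md\<close>.\<close>
  have Md: "Md h (v q) j k = ?e * a2 q j k"
    by (auto simp: Md_def a2_def a_def e)
  have "M q j k - mat_mul (M q) (L q) j k + mat_mul (L q) (M q) j k - M0 h j k - Md h (v q) j k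
      = ?e * (X2 q j k - mat_mul (X2 q) (L q) j k + mat_mul (L2 q) (X2 q) j k - mat_one j k - a2 q j k)"
    unfolding M_L LM M0 Md M_X2 by (simp add: algebra_simps)
  then show "norm (M q j k - mat_mul (M q) (L q) j k + mat_mul (L q) (M q) j k - M0 h j k - Md h (v q) j k)
      \<le> 1 * norm (X2 q j k - mat_mul (X2 q) (L q) j k + mat_mul (L2 q) (X2 q) j k - mat_one j k - a2 q j k)"
    by (simp add: norm_mult norm_osc)
qed simp

text \<open>Modulo \<open>T\<close> this is the identity minus \<open>L\<close>; the exponential is
  taken because it is exactly unitary.\<close>

definition U where "U q = mat_exp (\<lambda>j k. - L q j k)"

lemma unitary_U:
  assumes "q \<in> \<Omega>"
  shows "unitary_mat (U q)"
proof -
  have "inW (\<beta> q) (\<lambda>j k. - L q j k)"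
    using bigO_inW[OF bigO_uminus[OF bigO_J_imp_W[OF bigO_L]] assms I_facts(1)] .
  then show ?thesis unfolding U_def by (rule unitary_mat_exp) (simp add: L_skew[OF assms])
qed

definition U_rest where "U_rest q j k = U q j k - mat_one j k + L q j k"

lemma bigO_U_rest: "bigO wT (\<lambda>q t. U_rest q)"
proof -
  obtain d where d: "0 \<le> d" "\<And>q t. q \<in> \<Omega> \<Longrightarrow> t \<in> I \<Longrightarrow> bdd_by (wJ (\<beta> q)) d (\<lambda>j k. - L q j k)"
    using bigO_uminus[OF bigO_L] unfolding bigO_def by blast
  show ?thesis
  proof (rule bigOI)
    fix q t j k assume qt: "q \<in> \<Omega>" "t \<in> I"
    from bdd_byD[OF bdd_by_mat_exp[OF beta_nonneg[OF qt(1)] d(2)[OF qt]], of j k]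
    show "norm (U_rest q j k) \<le> (K * d * (K * d * exp (K * (d * 2)))) * wT (\<beta> q) j k"
      by (simp add: U_rest_def U_def)
  qed (use d K_pos in auto)
qed

text \<open>Expand with the identity minus \<open>L\<close> plus \<open>U_rest\<close> for
  \<open>U\<close>, and the identity plus \<open>L\<close> plus \<open>r\<close> for its adjoint.
  The terms of order at most one in \<open>L\<close> are those of \<open>bigO_M_commutator\<close>;
  the product of \<open>L\<close>, \<open>M\<close> and \<open>L\<close> is \<open>J\<close> times
  \<open>J\<close>, and every term with \<open>U_rest\<close> or \<open>r\<close> lies in the ideal
  \<open>T\<close>.\<close>

lemma bigO_conjugated_monodromy:
  "bigO wT (\<lambda>q t j k. mat_mul (mat_adj (U q)) (mat_mul (M q) (U q)) j k - M0 h j k - Md h (v q) j k)"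
proof -
  define r where "r q j k = cnj (U_rest q k j)" for q j k
  define Y where "Y q = mat_mul (M q) (U q)" for q
  have r: "bigO wT (\<lambda>q t. r q)"
  proof -
    obtain c where c: "0 \<le> c" "\<And>q t. q \<in> \<Omega> \<Longrightarrow> t \<in> I \<Longrightarrow> bdd_by (wT (\<beta> q)) c (U_rest q)"
      using bigO_U_rest unfolding bigO_def by blast
    show ?thesis
    proof (rule bigOI)
      fix q t j k assume qt: "q \<in> \<Omega>" "t \<in> I"
      \<comment> \<open>The weight is symmetric, so the adjoint of the remainder stays in
        \<open>T\<close>.\<close>
      have "wT (\<beta> q) k j = wT (\<beta> q) j k" by (simp add: wT_def kern_commute[of _ _ k j] mult.commute)
      then show "norm (r q j k) \<le> c * wT (\<beta> q) j k"
        using bdd_byD[OF c(2)[OF qt], of k j] by (simp add: r_def)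
    qed (use c in auto)
  qed
  have U: "U q = (\<lambda>j k. mat_one j k - L q j k + U_rest q j k)" for q
    by (simp add: fun_eq_iff U_rest_def)
  have adj: "mat_adj (U q) = (\<lambda>j k. mat_one j k + L q j k + r q j k)" if "q \<in> \<Omega>" for q
    using L_skew[OF that] by (auto simp: fun_eq_iff mat_adj_def U r_def mat_one_def)
  have LW: "bigO wW (\<lambda>q t. L q)" by (rule bigO_J_imp_W[OF bigO_L])
  have oL: "bigO wW (\<lambda>q t j k. mat_one j k - L q j k)" by (rule bigO_diff[OF bigO_one LW])
  have oL': "bigO wW (\<lambda>q t j k. mat_one j k + L q j k)" by (rule bigO_add[OF bigO_one LW])
  have UW: "bigO wW (\<lambda>q t. U q)"
    unfolding U by (intro bigO_add oL bigO_T_imp_W bigO_U_rest)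
  have YW: "bigO wW (\<lambda>q t. Y q)" unfolding Y_def by (intro bigO_WW bigO_M UW)
  have MT: "bigO wT (\<lambda>q t. mat_mul (M q) (U_rest q))" by (intro bigO_WT bigO_M bigO_U_rest)
  have M_L: "bigO wJ (\<lambda>q t. mat_mul (M q) (L q))" by (intro bigO_WJ bigO_M bigO_L)
  let ?E = "\<lambda>q j k. M q j k - mat_mul (M q) (L q) j k + mat_mul (L q) (M q) j k - M0 h j k - Md h (v q) j k"
  have "bigO wT (\<lambda>q t j k. ?E q j k + mat_mul (M q) (U_rest q) j k - mat_mul (L q) (mat_mul (M q) (L q)) j k
      + mat_mul (L q) (mat_mul (M q) (U_rest q)) j k + mat_mul (r q) (Y q) j k)"
    by (intro bigO_add bigO_diff[where F = "\<lambda>q t j k. _ q t j k + _ q t j k"] bigO_M_commutator MT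
        bigO_JJ[OF bigO_L M_L] bigO_WT[OF LW MT] bigO_TW[OF r YW])
  then show ?thesis
  proof (rule bigO_cong)
    fix q t j k assume qt: "q \<in> \<Omega>" "t \<in> I"
    note inW = bigO_inW[OF _ qt]
    have one: "inW (\<beta> q) mat_one" and L: "inW (\<beta> q) (L q)" and rest: "inW (\<beta> q) (U_rest q)"
      and M: "inW (\<beta> q) (M q)" and Y: "inW (\<beta> q) (Y q)" and rr: "inW (\<beta> q) (r q)"
      and M_L': "inW (\<beta> q) (mat_mul (M q) (L q))" and MT': "inW (\<beta> q) (mat_mul (M q) (U_rest q))"
      using inW bigO_one LW bigO_U_rest bigO_M YW r bigO_J_imp_W[OF M_L] MT bigO_T_imp_W by blast+
    have MmL: "inW (\<beta> q) (\<lambda>j k. M q j k - mat_mul (M q) (L q) j k)"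
      using inW[OF bigO_diff[OF bigO_M bigO_J_imp_W[OF M_L]]] .
    have Y_eq: "Y q = (\<lambda>j k. M q j k - mat_mul (M q) (L q) j k + mat_mul (M q) (U_rest q) j k)"
      unfolding Y_def by (subst U) (intro ext,
        simp only: mat_mul_add_right[OF inW[OF oL] rest M] mat_mul_diff_right[OF one L M] mat_mul_one_right)
    have "mat_mul (mat_adj (U q)) (Y q) j k = Y q j k + mat_mul (L q) (Y q) j k + mat_mul (r q) (Y q) j k"
      unfolding adj[OF qt(1)] mat_mul_add_left[OF inW[OF oL'] rr Y] mat_mul_add_left[OF one L Y] mat_mul_one_left ..
    also have "mat_mul (L q) (Y q) j k
        = mat_mul (L q) (M q) j k - mat_mul (L q) (mat_mul (M q) (L q)) j k + mat_mul (L q) (mat_mul (M q) (U_rest q)) j k"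
      by (subst Y_eq) (simp only: mat_mul_add_right[OF MmL MT' L] mat_mul_diff_right[OF M M_L' L])
    also have "Y q j k = M q j k - mat_mul (M q) (L q) j k + mat_mul (M q) (U_rest q) j k"
      by (subst Y_eq) simp
    finally show "mat_mul (mat_adj (U q)) (mat_mul (M q) (U q)) j k - M0 h j k - Md h (v q) j k
      = ?E q j k + mat_mul (M q) (U_rest q) j k - mat_mul (L q) (mat_mul (M q) (L q)) j k
      + mat_mul (L q) (mat_mul (M q) (U_rest q)) j k + mat_mul (r q) (Y q) j k"
      unfolding Y_def[symmetric] by simp
  qed
qed

lemma monodromy_normal_form:
  "\<exists>c. \<forall>q\<in>\<Omega>. \<exists>U. unitary_mat U \<and>
    (\<forall>j k. norm (mat_mul (mat_adj U) (mat_mul (W q (2 * pi)) U) j k - M0 h j k - Md h (v q) j k)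
      \<le> c * exp (- \<beta> q * \<bar>j - k\<bar>) / (jbr j * jbr k * jbr (j - k) powr (\<alpha> - 1)))"
proof -
  obtain c where c: "\<And>q t. q \<in> \<Omega> \<Longrightarrow> t \<in> I \<Longrightarrow> bdd_by (wT (\<beta> q)) c
      (\<lambda>j k. mat_mul (mat_adj (U q)) (mat_mul (M q) (U q)) j k - M0 h j k - Md h (v q) j k)"
    using bigO_conjugated_monodromy unfolding bigO_def by blast
  show ?thesis
  proof (intro exI[of _ c] ballI)
    fix q assume q: "q \<in> \<Omega>"
    show "\<exists>U. unitary_mat U \<and>
      (\<forall>j k. norm (mat_mul (mat_adj U) (mat_mul (W q (2 * pi)) U) j k - M0 h j k - Md h (v q) j k)
        \<le> c * exp (- \<beta> q * \<bar>j - k\<bar>) / (jbr j * jbr k * jbr (j - k) powr (\<alpha> - 1)))"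
    proof (intro exI[of _ "U q"] conjI allI unitary_U[OF q])
      fix j k
      show "norm (mat_mul (mat_adj (U q)) (mat_mul (W q (2 * pi)) (U q)) j k - M0 h j k - Md h (v q) j k)
        \<le> c * exp (- \<beta> q * \<bar>j - k\<bar>) / (jbr j * jbr k * jbr (j - k) powr (\<alpha> - 1))"
        using bdd_byD[OF c[OF q I_facts(1)], of j k] by (simp add: M_def wT_def kern_def mult_ac)
    qed
  qed
qed

end

theorem theorem1:
  fixes h \<alpha> cv :: real
  assumes "h > 0" and "\<alpha> > 2" and "cv > 0"
  shows "\<exists>c::real. \<forall>(\<beta>::real) (v::int \<Rightarrow> real \<Rightarrow> complex) (W::real \<Rightarrow> zmat).
     \<beta> \<ge> 0 \<longrightarrow> C_class \<alpha> \<beta> 2 cv v \<longrightarrow>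
     (\<forall>k t. v (-k) t = cnj (v k t)) \<longrightarrow>
     (\<forall>k t. v k (t + 2*pi) = v k t) \<longrightarrow>
     (\<forall>t. v 0 t = 0) \<longrightarrow>
     fund_sol h v W \<longrightarrow>
     (\<exists>U. unitary_mat U \<and>
        (\<forall>j k. norm (mat_mul (mat_adj U) (mat_mul (W (2*pi)) U) j k - M0 h j k - Md h v j k)
           \<le> c * exp (- \<beta> * \<bar>j - k\<bar>) / (jbr j * jbr k * jbr (j - k) powr (\<alpha> - 1))))"
proof -
  \<comment> \<open>\<open>h\<close>, \<alpha> and \<open>cv\<close> are fixed before this set is
    formed, so a bound uniform over it depends on nothing else.\<close>
  define \<Omega> where "\<Omega> = {(\<beta>, v, W). \<beta> \<ge> 0 \<and> C_class \<alpha> \<beta> 2 cv v \<and> (\<forall>k t. v (-k) t = cnj (v k t)) \<and>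
     (\<forall>k t. v k (t + 2*pi) = v k t) \<and> (\<forall>t. v 0 t = 0) \<and> fund_sol h v W}"
  interpret schroedinger_family \<alpha> \<Omega> fst h cv "\<lambda>q. fst (snd q)" "\<lambda>q. snd (snd q)"
    by standard (use assms in \<open>auto simp: \<Omega>_def\<close>)
  obtain c where c: "\<And>q. q \<in> \<Omega> \<Longrightarrow> \<exists>U. unitary_mat U \<and>
      (\<forall>j k. norm (mat_mul (mat_adj U) (mat_mul (snd (snd q) (2 * pi)) U) j k - M0 h j k - Md h (fst (snd q)) j k)
        \<le> c * exp (- fst q * real_of_int \<bar>j - k\<bar>) / (jbr j * jbr k * jbr (j - k) powr (\<alpha> - 1)))"
    using monodromy_normal_form by blast
  show ?thesis
  proof (rule exI[of _ c], intro allI impI)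
    fix \<beta> :: real and v W
    assume "\<beta> \<ge> 0" "C_class \<alpha> \<beta> 2 cv v" "\<forall>k t. v (-k) t = cnj (v k t)"
      "\<forall>k t. v k (t + 2*pi) = v k t" "\<forall>t. v 0 t = 0" "fund_sol h v W"
    then have "(\<beta>, v, W) \<in> \<Omega>" by (simp add: \<Omega>_def)
    from c[OF this] show "\<exists>U. unitary_mat U \<and>
        (\<forall>j k. norm (mat_mul (mat_adj U) (mat_mul (W (2*pi)) U) j k - M0 h j k - Md h v j k)
           \<le> c * exp (- \<beta> * \<bar>j - k\<bar>) / (jbr j * jbr k * jbr (j - k) powr (\<alpha> - 1)))"
      by simp
  qed
qed

end
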